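(* Let $W=\{W_t:t\ge0\}$ be a standard real Brownian motion on a complete probability space and let $\xi\in\mathbb{R}$. Let $a:(0,\infty)\to(0,\infty)$ be a continuous function such that $\lim_{t\to\infty}\int_t^{t+\eta}a(s)\,ds>0$ for some $\eta>0$. Let $b:\mathbb{R}\to[0,\infty)$ be a continuous function for which there exist $-\infty\le l<\infty$ and $-\infty<r<\infty$ such that $b>0$ and $b$ is locally Lipschitz on $(l,\infty)$, and $b:[r,\infty)\to(0,\infty)$ is non-decreasing. Let $f:[0,\infty)\to\mathbb{R}$ be square-integrable on $[0,K]$ for every $K>0$, with $\int_0^\infty f^2(s)\,ds=\infty$ and $$\sum_{n=M}^\infty\frac{1}{\Upsilon^p(n)}\left(\int_n^{n+2}f^2(s)\,ds\right)^{p/2}<\infty\quad\text{for some } M,p>0,$$ where $$\Upsilon(t)=\sqrt{2\left(\int_0^tf^2(s)\,ds\right)\log\log\left(e^e\vee\int_0^tf^2(s)\,ds\right)} .$$ Then the stochastic differential equation $$X_t^\xi=\xi+\int_0^ta(s)b(X_s^\xi)\,ds+I_t,\qquad I_t=\int_0^tf(s)\,dW_s,$$ blows up in finite time with probability $1$ if and only if $\int_r^\infty\frac{ds}{b(s)}<\infty$.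
   Context: In the sum, $n$ runs over integers $n\ge M$ ($M$ a positive integer). $I$ is taken with continuous paths. The solution is understood up to its explosion time $T_\xi^X=\inf\{t\ge0:X_t^\xi\notin\mathbb{R}\}$ ($\inf\emptyset=\infty$), and "blows up in finite time with probability 1" means $P(T_\xi^X<\infty)=1$. $\vee$ denotes the maximum. *)

theory Defs
  imports "HOL-Probability.Probability"
begin

text \<open>Functions with domain $[0,\infty)$ or $(0,\infty)$ are total functions on the reals whose
  values outside the domain are never used. Deterministic integrals are taken with respect to
  \<^const>\<open>lebesgue\<close>, so integrands need only be Lebesgue measurable.\<close>

locale brownian_motion = prob_space P for P :: "'a measure" +
  fixes W :: "real \<Rightarrow> 'a \<Rightarrow> real"
  assumes W_measurable: "\<And>t. 0 \<le> t \<Longrightarrow> W t \<in> borel_measurable P"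
    and W_0: "AE \<omega> in P. W 0 \<omega> = 0"
    and W_normal: "\<And>s t. 0 \<le> s \<Longrightarrow> s < t \<Longrightarrow>
      distributed P lborel (\<lambda>\<omega>. W t \<omega> - W s \<omega>) (normal_density 0 (sqrt (t - s)))"
    and W_indep: "\<And>(n::nat) \<tau>. 0 \<le> \<tau> 0 \<Longrightarrow> (\<And>i. i < n \<Longrightarrow> \<tau> i < \<tau> (Suc i)) \<Longrightarrow>
      indep_vars (\<lambda>_. borel) (\<lambda>i \<omega>. W (\<tau> (Suc i)) \<omega> - W (\<tau> i) \<omega>) {..<n}"
    and W_continuous: "AE \<omega> in P. continuous_on {0..} (\<lambda>t. W t \<omega>)"


text \<open>A list of triples $(c,u,v)$ encodes the step function $\sum c\,1_{(u,v]}$. The intervals may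
  overlap.\<close>

definition step_list :: "real \<Rightarrow> (real \<times> real \<times> real) list \<Rightarrow> bool" where
  "step_list t ps \<longleftrightarrow> (\<forall>(c, u, v) \<in> set ps. 0 \<le> u \<and> u \<le> v \<and> v \<le> t)"

definition step_fun :: "(real \<times> real \<times> real) list \<Rightarrow> real \<Rightarrow> real" where
  "step_fun ps s = (\<Sum>(c, u, v)\<leftarrow>ps. c * indicator {u<..v} s)"

definition step_integral ::
    "(real \<Rightarrow> 'a \<Rightarrow> real) \<Rightarrow> (real \<times> real \<times> real) list \<Rightarrow> 'a \<Rightarrow> real" where
  "step_integral W ps \<omega> = (\<Sum>(c, u, v)\<leftarrow>ps. c * (W v \<omega> - W u \<omega>))"

text \<open>\<open>Y\<close> is a version of the Wiener integral $\int_0^t f(s)\,dW_s$, i.e. the $L^2(P)$-limit of the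
  integrals of step functions converging to \<open>f\<close> in $L^2[0,t]$; by the isometry it is
  determined up to a null set.\<close>

definition wiener_integral ::
    "'a measure \<Rightarrow> (real \<Rightarrow> 'a \<Rightarrow> real) \<Rightarrow> (real \<Rightarrow> real) \<Rightarrow> real \<Rightarrow> ('a \<Rightarrow> real) \<Rightarrow> bool" where
  "wiener_integral P W f t Y \<longleftrightarrow> Y \<in> borel_measurable P \<and>
    (\<exists>ps. (\<forall>n::nat. step_list t (ps n)) \<and>
      (\<lambda>n. \<integral>\<^sup>+s\<in>{0..t}. ennreal ((f s - step_fun (ps n) s)\<^sup>2) \<partial>lebesgue) \<longlonglongrightarrow> 0 \<and>
      (\<lambda>n. \<integral>\<^sup>+\<omega>. ennreal ((Y \<omega> - step_integral W (ps n) \<omega>)\<^sup>2) \<partial>P) \<longlonglongrightarrow> 0)"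

definition continuous_wiener_process ::
    "'a measure \<Rightarrow> (real \<Rightarrow> 'a \<Rightarrow> real) \<Rightarrow> (real \<Rightarrow> real) \<Rightarrow> (real \<Rightarrow> 'a \<Rightarrow> real) \<Rightarrow> bool" where
  "continuous_wiener_process P W f I \<longleftrightarrow>
    (\<forall>t\<ge>0. wiener_integral P W f t (I t)) \<and> (AE \<omega> in P. continuous_on {0..} (\<lambda>t. I t \<omega>))"


definition explosion_time :: "(real \<Rightarrow> 'a \<Rightarrow> ereal) \<Rightarrow> 'a \<Rightarrow> ereal" where
  "explosion_time X \<omega> = (INF t\<in>{t. 0 \<le> t \<and> X t \<omega> \<notin> range ereal}. ereal t)"

text \<open>\<open>X\<close> solves $X_t = \xi + \int_0^t a(s)\,b(X_s)\,ds + I_t$ up to its explosion time $T$. If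
  $T<\infty$ then \<open>X\<close> is not real at $T$, and as it is continuous at $T$ as an extended-real path,
  $|X_t|\to\infty$ as $t\uparrow T$; so \<open>X\<close> cannot be stopped before it really explodes.
  Nothing is required of the path after $T$. The condition $X_0=\xi$ excludes $T=0$.\<close>

definition solves_up_to_explosion ::
    "'a measure \<Rightarrow> (real \<Rightarrow> real) \<Rightarrow> (real \<Rightarrow> real) \<Rightarrow> real \<Rightarrow> (real \<Rightarrow> 'a \<Rightarrow> real) \<Rightarrow>
      (real \<Rightarrow> 'a \<Rightarrow> ereal) \<Rightarrow> bool" where
  "solves_up_to_explosion P a b \<xi> I X \<longleftrightarrow>
    (\<forall>t\<ge>0. X t \<in> borel_measurable P) \<and>
    (AE \<omega> in P.
      X 0 \<omega> = ereal \<xi> \<and>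
      continuous_on {t. 0 \<le> t \<and> ereal t \<le> explosion_time X \<omega>} (\<lambda>t. X t \<omega>) \<and>
      (\<forall>t\<ge>0. ereal t = explosion_time X \<omega> \<longrightarrow> X t \<omega> \<notin> range ereal) \<and>
      (\<forall>t\<ge>0. ereal t < explosion_time X \<omega> \<longrightarrow>
        set_integrable lebesgue {0<..t} (\<lambda>s. a s * b (real_of_ereal (X s \<omega>))) \<and>
        X t \<omega> = ereal (\<xi> + (LINT s:{0<..t}|lebesgue. a s * b (real_of_ereal (X s \<omega>))) + I t \<omega>)))"

definition blows_up_almost_surely :: "'a measure \<Rightarrow> (real \<Rightarrow> 'a \<Rightarrow> ereal) \<Rightarrow> bool" where
  "blows_up_almost_surely P X \<longleftrightarrow> measure P {\<omega> \<in> space P. explosion_time X \<omega> < \<infinity>} = 1"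


text \<open>$V(t)\to\infty$ makes \<open>Upsilon f\<close> eventually positive, so in a condition of the form
  "$\sum_{n\ge M}$ converges for some $M$" the convention $1/0=0$ makes no difference.\<close>

definition Upsilon :: "(real \<Rightarrow> real) \<Rightarrow> real \<Rightarrow> real" where
  "Upsilon f t = (let V = LINT s:{0..t}|lebesgue. (f s)\<^sup>2
    in sqrt (2 * V * ln (ln (max (exp (exp 1)) V))))"

end

theory Submission
  imports Defs
begin

text \<open>Put \<open>D t = \<integral>\<^sub>0\<^sup>t a(s) b(X\<^sub>s) ds\<close>, so that \<open>X = \<xi> + D + I\<close> with \<open>D\<close> non-decreasing, and let \<open>G\<close>
be an antiderivative of \<open>1 / b\<close> on \<open>[r, \<infinity>)\<close>. The Osgood integral converges if and only if \<open>G\<close> is bounded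
above (\<open>osgood_integral_finite_iff\<close>), and \<open>G\<close> serves as a clock in both directions.

If \<open>G\<close> is unbounded, no path explodes. Indeed \<open>I\<close> is bounded on \<open>[0, T]\<close> and \<open>D \<ge> 0\<close>, so a path that
explodes at \<open>T < \<infinity>\<close> tends to \<open>+\<infinity>\<close>. Near \<open>T\<close> it lies below \<open>y = const + D\<close>, where
\<open>y' = a b(X) \<le> a b(y)\<close>. Hence \<open>(G \<circ> y)' \<le> a\<close> stays bounded while \<open>y \<rightarrow> \<infinity>\<close>, which bounds \<open>G\<close>
(\<open>explosion_imp_osgood_bounded\<close>).

If \<open>G \<le> B\<close>, suppose that a path never explodes. Whenever \<open>I\<^sub>s \<ge> c := r - \<xi>\<close> we have
\<open>X\<^sub>s \<ge> r + D s\<close>, so that \<open>(G(r + D))' = a b(X) / b(r + D) \<ge> a\<close> at such times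
(\<open>global_solution_clock\<close>). The bounded clock \<open>G(r + D)\<close> therefore dominates the time, weighted by
\<open>a\<close>, that \<open>I\<close> spends above \<open>c\<close>. The contradiction is that this weighted time is almost surely infinite,
whatever the level \<open>c\<close> (\<open>clock_unbounded\<close>). Heuristically, \<open>I\<^sub>s\<close> is centred normal with variance tending to
infinity, so it exceeds \<open>c\<close> with probability near \<open>1/2\<close>, and the total weight \<open>\<integral> a\<close> is infinite.

To make this almost sure, time is cut into consecutive blocks \<open>[\<tau>\<^sub>k, \<tau>\<^sub>k\<^sub>+\<^sub>1]\<close>, chosen one after the other so
long that on the final part of the block, which carries \<open>a\<close>-weight at least \<open>1\<close>, the increment of \<open>I\<close> since
\<open>\<tau>\<^sub>k\<close> dominates the value \<open>I\<close> had at \<open>\<tau>\<^sub>k\<close>. Each block has a good event of probability bounded below on which a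
fixed amount of weighted time is spent above \<open>c\<close>, up to an exceptional event of probability at most
\<open>2\<^sup>-\<^sup>k\<close> (\<open>sojourn_block_exists\<close>). The good event is defined through finitely many increments of \<open>W\<close>
inside the block, with step integrals in place of \<open>I\<close>. So the good events of different blocks are exactly
independent (\<open>increment_events_indep\<close>), the zero-one law makes infinitely many of them occur, and the
Borel--Cantelli lemma removes the exceptional events.\<close>

section \<open>Scalar comparison with the Osgood integral\<close>

text \<open>Cutting \<open>b\<close> off below \<open>r\<close> keeps the integrand continuous and positive on the whole line, so that
\<open>G\<close> has two-sided derivatives even at \<open>r\<close>, where the comparison argument may start.\<close>

lemma osgood_antiderivative_exists:
  fixes b :: "real \<Rightarrow> real"
  assumes "continuous_on UNIV b" and "\<And>x. x \<ge> r \<Longrightarrow> b x > 0"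
  shows "\<exists>G. \<forall>y. (G has_real_derivative 1 / b (max r y)) (at y)"
proof -
  have "continuous_on UNIV (\<lambda>y. 1 / b (max r y))"
    using assms(2)[of "max r _"]
    by (intro continuous_intros continuous_on_compose2[OF assms(1)])
      (auto simp: less_imp_neq[symmetric])
  then have "isCont (\<lambda>y. 1 / b (max r y)) y" for y
    by (simp add: continuous_on_eq_continuous_at)
  then obtain G where "\<forall>y::real. -\<infinity> < ereal y \<longrightarrow> ereal y < \<infinity> \<longrightarrow>
      (G has_vector_derivative 1 / b (max r y)) (at y)"
    using einterval_antiderivative[of "-\<infinity>" "\<infinity>" "\<lambda>y. 1 / b (max r y)"] by auto
  then show ?thesis
    by (auto simp: has_real_derivative_iff_has_vector_derivative)
qed

lemma antiderivative_on_pos_exists: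
  fixes a :: "real \<Rightarrow> real"
  assumes "continuous_on {0<..} a"
  shows "\<exists>A. \<forall>t>0. (A has_real_derivative a t) (at t)"
proof -
  have "isCont a t" if "t > 0" for t
    using assms that by (simp add: continuous_on_eq_continuous_at)
  then obtain A where "\<forall>t::real. 0 < ereal t \<longrightarrow> ereal t < \<infinity> \<longrightarrow>
      (A has_vector_derivative a t) (at t)"
    using einterval_antiderivative[of 0 "\<infinity>" a] by auto
  then show ?thesis
    by (auto simp: has_real_derivative_iff_has_vector_derivative)
qed

text \<open>The value of the integral is \<open>sup G - G r\<close>, since \<open>G\<close> is non-decreasing. The boundedness of \<open>G\<close> is
the form in which both directions of the theorem use the Osgood condition.\<close>

lemma osgood_integral_finite_iff:
  fixes b :: "real \<Rightarrow> real"
  assumes b: "continuous_on UNIV b" "\<And>x. x \<ge> r \<Longrightarrow> b x > 0"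
    and G: "\<And>y. (G has_real_derivative 1 / b (max r y)) (at y)"
  shows "(\<integral>\<^sup>+x\<in>{r..}. ennreal (1 / b x) \<partial>lebesgue) < \<infinity> \<longleftrightarrow> (\<exists>B. \<forall>y. G y \<le> B)"
proof -
  let ?g = "\<lambda>y. 1 / b (max r y)"
  have cont: "continuous_on UNIV ?g"
    using b(2)[of "max r _"]
    by (intro continuous_intros continuous_on_compose2[OF b(1)])
      (auto simp: less_imp_neq[symmetric])
  have meas: "?g \<in> borel_measurable borel"
    by (rule borel_measurable_continuous_onI[OF cont])
  have pos: "0 \<le> ?g y" for y
    using b(2)[of "max r y"] by simp
  have mono: "G x \<le> G y" if "x \<le> y" for x y
    using DERIV_nonneg_imp_nondecreasing[OF that, of G] G pos by blast
  have eq: "(\<integral>\<^sup>+x\<in>{r..}. ennreal (1 / b x) \<partial>lebesgue) = (\<integral>\<^sup>+x. ennreal (?g x) * indicator {r..} x \<partial>lborel)"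
    unfolding nn_integral_completion
    by (intro nn_integral_cong) (auto split: split_indicator simp: max_def)
  show ?thesis
  proof
    assume fin: "(\<integral>\<^sup>+x\<in>{r..}. ennreal (1 / b x) \<partial>lebesgue) < \<infinity>"
    define J where "J = (\<integral>\<^sup>+x. ennreal (?g x) * indicator {r..} x \<partial>lborel)"
    have J: "J < \<infinity>" using fin unfolding J_def eq .
    have "G y \<le> G r + enn2real J" for y
    proof (cases "r \<le> y")
      case True
      have "ennreal (G y - G r) = (\<integral>\<^sup>+x. ennreal (?g x) * indicator {r..y} x \<partial>lborel)"
        by (rule nn_integral_FTC_Icc[symmetric, OF meas G pos True])
      also have "\<dots> \<le> J"
        unfolding J_def by (intro nn_integral_mono) (auto split: split_indicator)
      finally have "ennreal (G y - G r) \<le> J" .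
      then have "G y - G r \<le> enn2real J"
        using J enn2real_mono[of "ennreal (G y - G r)" J] mono[OF True] by simp
      then show ?thesis by simp
    next
      case False
      then show ?thesis using mono[of y r] by (simp add: add_increasing2)
    qed
    then show "\<exists>B. \<forall>y. G y \<le> B" by blast
  next
    assume "\<exists>B. \<forall>y. G y \<le> B"
    then obtain B where B: "\<And>y. G y \<le> B" by blast
    have "(G \<longlongrightarrow> (SUP y. G y)) at_top"
    proof (rule increasing_tendsto)
      have bdd: "bdd_above (range G)" using B by (intro bdd_aboveI2[of _ _ B]) auto
      show "\<forall>\<^sub>F y in at_top. G y \<le> (SUP y. G y)"
        by (auto intro!: always_eventually cSUP_upper bdd)
      fix z assume "z < (SUP y. G y)"
      then obtain y0 where "z < G y0"
        using less_cSUP_iff[OF _ bdd] by auto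
      then show "\<forall>\<^sub>F y in at_top. z < G y"
        using mono by (auto simp: eventually_at_top_linorder intro!: exI[of _ y0] intro: less_le_trans)
    qed
    then have "(\<integral>\<^sup>+x. ennreal (?g x) * indicator {r..} x \<partial>lborel) = ennreal ((SUP y. G y) - G r)"
      by (rule nn_integral_FTC_atLeast[OF meas G pos])
    then show "(\<integral>\<^sup>+x\<in>{r..}. ennreal (1 / b x) \<partial>lebesgue) < \<infinity>"
      unfolding eq by simp
  qed
qed

text \<open>Continuity of \<open>k\<close> is known only away from \<open>0\<close>, where \<open>a\<close> may be singular. Splitting the integral at
some \<open>t\<^sub>0 > 0\<close> leaves a constant and an integral over a compact interval on which \<open>k\<close> is continuous.\<close>

lemma set_integral_upper_limit_has_derivative:
  fixes k :: "real \<Rightarrow> real" and T :: ereal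
  assumes cont: "\<And>t. 0 < t \<Longrightarrow> ereal t < T \<Longrightarrow> isCont k t"
    and int: "\<And>t. 0 \<le> t \<Longrightarrow> ereal t < T \<Longrightarrow> set_integrable lebesgue {0<..t} k"
    and t: "0 < t" "ereal t < T"
  shows "((\<lambda>t. LINT s:{0<..t}|lebesgue. k s) has_real_derivative k t) (at t)"
proof -
  let ?D = "\<lambda>t. LINT s:{0<..t}|lebesgue. k s"
  obtain t1 where t1: "t < t1" "ereal t1 < T"
    using ereal_dense2[OF t(2)] by auto
  define t0 where "t0 = t / 2"
  have t0: "0 < t0" "t0 < t" using t by (auto simp: t0_def)
  have k: "continuous_on {t0..t1} k"
    using t0 t1 by (intro continuous_at_imp_continuous_on ballI cont)
      (auto intro: le_less_trans[of _ "ereal t1"])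
  have D: "?D y = ?D t0 + integral {t0..y} k" if y: "y \<in> {t0..t1}" for y
  proof -
    have le: "ereal y < T" using y t1 by (auto intro: le_less_trans[of _ "ereal t1"])
    have ky: "continuous_on {t0..y} k" using k by (rule continuous_on_subset) (use y in auto)
    have abs: "set_integrable lebesgue {t0..y} k"
      using absolutely_integrable_continuous_real[OF ky] .
    have eq: "{0<..y} = {0<..t0} \<union> {t0<..y}" using y t0 by auto
    have "?D y = ?D t0 + (LINT s:{t0<..y}|lebesgue. k s)"
      unfolding eq
    proof (rule set_integral_Un)
      show "set_integrable lebesgue {0<..t0} k"
        using y t0 by (intro set_integrable_subset[OF int[OF _ le]]) auto
      show "set_integrable lebesgue {t0<..y} k"
        by (intro set_integrable_subset[OF abs]) auto
    qed auto
    also have "(LINT s:{t0<..y}|lebesgue. k s) = (LINT s:{t0..y}|lebesgue. k s)"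
    proof -
      have "AE s in lebesgue. s \<noteq> t0"
        by (rule AE_I[of _ _ "{t0}"]) auto
      then show ?thesis
        unfolding set_lebesgue_integral_def
      proof (intro integral_cong_AE)
        have "set_integrable lebesgue {t0<..y} k"
          by (intro set_integrable_subset[OF abs]) auto
        then show "(\<lambda>s. indicat_real {t0<..y} s *\<^sub>R k s) \<in> borel_measurable lebesgue"
          unfolding set_integrable_def by (rule borel_measurable_integrable)
        show "(\<lambda>s. indicat_real {t0..y} s *\<^sub>R k s) \<in> borel_measurable lebesgue"
          using abs unfolding set_integrable_def by (rule borel_measurable_integrable)
      qed (auto split: split_indicator elim!: eventually_mono)
    qed
    also have "\<dots> = integral {t0..y} k"
      using set_lebesgue_integral_eq_integral(2)[OF abs] .
    finally show ?thesis .
  qed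
  have "((\<lambda>y. ?D t0 + integral {t0..y} k) has_real_derivative k t) (at t within {t0..t1})"
    using integral_has_real_derivative[OF k, of t] t0 t1
    by (auto intro!: derivative_eq_intros)
  then have "(?D has_real_derivative k t) (at t within {t0..t1})"
    by (rule has_field_derivative_transform_within[of _ _ _ _ 1])
      (use t0 t1 in \<open>simp_all only: D, simp_all\<close>)
  then show ?thesis
    using at_within_Icc_at[OF t0(2) t1(1)] by simp
qed

text \<open>With \<open>C\<close> a bound for \<open>\<bar>i\<bar>\<close> on \<open>[0, T]\<close>, the function \<open>y = \<xi> + C + D\<close> lies above \<open>x\<close>. As
\<open>b\<close> is non-decreasing on \<open>[r, \<infinity>)\<close>, \<open>G \<circ> y\<close> grows at a rate of at most \<open>a\<close>, which is bounded near
\<open>T\<close>. But \<open>y\<close> takes arbitrarily large values.\<close>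

lemma explosion_imp_osgood_bounded:
  fixes a b x D i :: "real \<Rightarrow> real"
  assumes b: "continuous_on UNIV b" "\<And>x. b x \<ge> 0" "\<And>x. x \<ge> r \<Longrightarrow> b x > 0" "mono_on {r..} b"
    and G: "\<And>y. (G has_real_derivative 1 / b (max r y)) (at y)"
    and a: "continuous_on {0<..} a" "\<And>t. t > 0 \<Longrightarrow> a t > 0"
    and T: "0 < T"
    and i: "continuous_on {0..T} i"
    and x: "\<And>t. 0 \<le> t \<Longrightarrow> t < T \<Longrightarrow> x t = \<xi> + D t + i t"
    and D: "\<And>t. 0 < t \<Longrightarrow> t < T \<Longrightarrow> (D has_real_derivative a t * b (x t)) (at t)"
    and lim: "filterlim x at_top (at_left T)"
  shows "\<exists>B. \<forall>y. G y \<le> B"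
proof -
  have mono: "G x \<le> G y" if "x \<le> y" for x y
    using DERIV_nonneg_imp_nondecreasing[OF that, of G] G b(2) by (metis divide_nonneg_nonneg zero_le_one)
  have "\<exists>C. \<forall>t\<in>{0..T}. \<bar>i t\<bar> \<le> C"
    using compact_imp_bounded[OF compact_continuous_image[OF i compact_Icc]]
    by (auto simp: bounded_real)
  then obtain C where C: "\<And>t. t \<in> {0..T} \<Longrightarrow> \<bar>i t\<bar> \<le> C"
    by blast
  define y where "y = (\<lambda>t. \<xi> + C + D t)"
  have "\<forall>\<^sub>F t in at_left T. x t \<ge> r \<and> t > 0"
    using lim eventually_mono[OF eventually_at_left_real[OF T], of "\<lambda>t. t > 0"]
    by (auto simp: filterlim_at_top intro: eventually_conj)
  then obtain t0 where t0: "t0 < T" "\<And>t. t0 < t \<Longrightarrow> t < T \<Longrightarrow> x t \<ge> r \<and> t > 0"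
    using T by (auto simp: eventually_at_left)
  \<comment> \<open>From \<open>t1\<close> on, the path is above \<open>r\<close>; as \<open>t1 > 0\<close>, the weight \<open>a\<close> is bounded on \<open>[t1, T]\<close>.\<close>
  define t1 where "t1 = (max t0 0 + T) / 2"
  have t1: "t0 < t1" "0 < t1" "t1 < T" using t0(1) T by (auto simp: t1_def max_def)
  have "continuous_on {t1..T} a" using a(1) by (rule continuous_on_subset) (use t1 in auto)
  then have "\<exists>m. \<forall>t\<in>{t1..T}. \<bar>a t\<bar> \<le> m"
    using compact_imp_bounded[OF compact_continuous_image[OF _ compact_Icc]]
    by (force simp: bounded_real)
  then obtain m where m: "\<And>t. t \<in> {t1..T} \<Longrightarrow> \<bar>a t\<bar> \<le> m"
    by blast
  have bound: "G (y t) \<le> G (y t1) + m * (T - t1)" if t: "t1 \<le> t" "t < T" for t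
  proof -
    \<comment> \<open>\<open>(G \<circ> y)' = a b(x) / b(y) \<le> a \<le> m\<close>\<close>
    have "m * t1 - G (y t1) \<le> m * t - G (y t)"
    proof (rule DERIV_nonneg_imp_nondecreasing[OF t(1)])
      fix s assume s: "t1 \<le> s" "s \<le> t"
      have sT: "0 < s" "s < T" using s t t1 by auto
      have xy: "r \<le> x s" "x s \<le> y s"
        using t0(2)[of s] s t1 sT x[of s] C[of s] by (auto simp: y_def)
      have dy: "(y has_real_derivative a s * b (x s)) (at s)"
        unfolding y_def using D[OF sT] by (auto intro!: derivative_eq_intros)
      have "((\<lambda>s. m * s - G (y s)) has_real_derivative m - 1 / b (max r (y s)) * (a s * b (x s))) (at s)"
        by (auto intro!: derivative_eq_intros DERIV_chain2[OF G] dy)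
      moreover have "1 / b (max r (y s)) * (a s * b (x s)) \<le> m"
      proof -
        have "b (x s) \<le> b (y s)" using b(4) xy by (auto simp: mono_on_def)
        then have "a s * b (x s) \<le> a s * b (y s)"
          using a(2)[OF sT(1)] by (intro mult_left_mono) auto
        also have "\<dots> \<le> m * b (y s)"
          using m[of s] s t b(2) by (intro mult_right_mono) auto
        finally show ?thesis
          using b(3)[of "y s"] xy by (simp add: max_def divide_simps mult.commute)
      qed
      ultimately show "\<exists>z. ((\<lambda>s. m * s - G (y s)) has_real_derivative z) (at s) \<and> 0 \<le> z"
        by (intro exI[of _ "m - 1 / b (max r (y s)) * (a s * b (x s))"]) auto
    qed
    moreover have "m * t \<le> m * T"
      using m[of t1] t t1 by (intro mult_left_mono) auto
    ultimately show ?thesis by (simp add: algebra_simps)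
  qed
  have "G z \<le> G (y t1) + m * (T - t1)" for z
  proof -
    have "\<forall>\<^sub>F t in at_left T. x t \<ge> z \<and> t \<in> {t1<..<T}"
      using lim eventually_at_left_real[OF t1(3)]
      by (auto simp: filterlim_at_top intro: eventually_conj)
    then obtain t where t: "x t \<ge> z" "t1 < t" "t < T"
      using eventually_happens'[of "at_left T"] by (auto simp: trivial_limit_at_left_real)
    have "x t \<le> y t" using x[of t] C[of t] t t1 by (auto simp: y_def)
    then have "G z \<le> G (y t)" using t by (intro mono) auto
    then show ?thesis using bound[of t] t by auto
  qed
  then show ?thesis by blast
qed

text \<open>For \<open>A\<close> an antiderivative of a weight \<open>a\<close>, this says without any integral over the set
\<open>{s. c \<le> i s}\<close> that the increments of \<open>H\<close> dominate the \<open>a\<close>-weighted time that \<open>i\<close> spends above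
\<open>c\<close>: only whole intervals spent above \<open>c\<close> are counted.\<close>

definition clock_above :: "(real \<Rightarrow> real) \<Rightarrow> (real \<Rightarrow> real) \<Rightarrow> real \<Rightarrow> (real \<Rightarrow> real) \<Rightarrow> bool" where
  "clock_above A i c H \<longleftrightarrow> mono_on {1..} H \<and>
    (\<forall>p q. 1 \<le> p \<longrightarrow> p \<le> q \<longrightarrow> (\<forall>s\<in>{p..q}. c \<le> i s) \<longrightarrow> A q - A p \<le> H q - H p)"

text \<open>While \<open>i \<ge> r - \<xi>\<close> the solution satisfies \<open>x \<ge> r + D \<ge> r\<close>, and monotonicity of \<open>b\<close> gives
\<open>D' = a b(x) \<ge> a b(r + D)\<close>. At the remaining times \<open>D' \<ge> 0\<close> is enough.\<close>

lemma global_solution_clock: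
  fixes a b x D i :: "real \<Rightarrow> real"
  assumes b: "\<And>x. b x \<ge> 0" "\<And>x. x \<ge> r \<Longrightarrow> b x > 0" "mono_on {r..} b"
    and G: "\<And>y. (G has_real_derivative 1 / b (max r y)) (at y)"
    and a: "\<And>t. t > 0 \<Longrightarrow> a t > 0" "\<And>t. t > 0 \<Longrightarrow> (A has_real_derivative a t) (at t)"
    and x: "\<And>t. 0 \<le> t \<Longrightarrow> x t = \<xi> + D t + i t"
    and D: "\<And>t. 0 < t \<Longrightarrow> (D has_real_derivative a t * b (x t)) (at t)"
    and D0: "\<And>t. 0 < t \<Longrightarrow> D t \<ge> 0"
  shows "clock_above A i (r - \<xi>) (\<lambda>t. G (r + D t))"
proof -
  let ?h = "\<lambda>s. 1 / b (max r (r + D s)) * (a s * b (x s))"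
  have deriv: "((\<lambda>t. G (r + D t)) has_real_derivative ?h s) (at s)" if "0 < s" for s
  proof -
    have "((\<lambda>t. r + D t) has_real_derivative a s * b (x s)) (at s)"
      by (auto intro!: derivative_eq_intros D[OF that])
    from DERIV_chain2[OF G this] show ?thesis .
  qed
  have nonneg: "0 \<le> ?h s" if "0 < s" for s
    using a(1)[OF that] b(1) by (intro mult_nonneg_nonneg divide_nonneg_nonneg) auto
  have "mono_on {1..} (\<lambda>t. G (r + D t))"
  proof (rule mono_onI)
    fix p q :: real assume pq: "p \<in> {1..}" "q \<in> {1..}" "p \<le> q"
    show "G (r + D p) \<le> G (r + D q)"
    proof (rule DERIV_nonneg_imp_nondecreasing[OF pq(3)])
      fix s assume "p \<le> s" "s \<le> q"
      then have "0 < s" using pq by auto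
      then show "\<exists>y. ((\<lambda>t. G (r + D t)) has_real_derivative y) (at s) \<and> 0 \<le> y"
        using deriv nonneg by blast
    qed
  qed
  moreover have "A q - A p \<le> G (r + D q) - G (r + D p)"
    if pq: "1 \<le> p" "p \<le> q" and above: "\<forall>s\<in>{p..q}. r - \<xi> \<le> i s" for p q
  proof -
    have "G (r + D p) - A p \<le> G (r + D q) - A q"
    proof (rule DERIV_nonneg_imp_nondecreasing[OF pq(2)])
      fix s assume s: "p \<le> s" "s \<le> q"
      then have s0: "0 < s" using pq by auto
      have "((\<lambda>t. G (r + D t) - A t) has_real_derivative ?h s - a s) (at s)"
        by (intro DERIV_diff deriv a(2) s0)
      moreover have "a s \<le> ?h s"
      proof -
        have le: "r + D s \<le> x s" "r \<le> r + D s"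
          using x[of s] above s s0 D0[OF s0] by (auto simp: algebra_simps)
        then have "b (r + D s) \<le> b (x s)" using b(3) by (auto simp: mono_on_def)
        then have "a s * b (r + D s) \<le> a s * b (x s)"
          using a(1)[OF s0] by (intro mult_left_mono) auto
        then show ?thesis
          using b(2)[of "r + D s"] D0[OF s0] by (simp add: max_def field_simps)
      qed
      ultimately show "\<exists>y. ((\<lambda>t. G (r + D t) - A t) has_real_derivative y) (at s) \<and> 0 \<le> y"
        by (intro exI[of _ "?h s - a s"]) auto
    qed
    then show ?thesis by simp
  qed
  ultimately show ?thesis by (auto simp: clock_above_def)
qed

text \<open>The pathwise content of \<^const>\<open>solves_up_to_explosion\<close>, for one path \<open>x\<close> with driving path \<open>i\<close> and
explosion time \<open>T\<close>.\<close>

definition solution_path ::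
    "(real \<Rightarrow> real) \<Rightarrow> (real \<Rightarrow> real) \<Rightarrow> real \<Rightarrow> (real \<Rightarrow> real) \<Rightarrow> ereal \<Rightarrow> (real \<Rightarrow> ereal) \<Rightarrow> bool" where
  "solution_path a b \<xi> i T x \<longleftrightarrow>
    x 0 = ereal \<xi> \<and> continuous_on {t. 0 \<le> t \<and> ereal t \<le> T} x \<and>
    (\<forall>t\<ge>0. ereal t = T \<longrightarrow> x t \<notin> range ereal) \<and>
    (\<forall>t\<ge>0. ereal t < T \<longrightarrow>
      set_integrable lebesgue {0<..t} (\<lambda>s. a s * b (real_of_ereal (x s))) \<and>
      x t = ereal (\<xi> + (LINT s:{0<..t}|lebesgue. a s * b (real_of_ereal (x s))) + i t))"

text \<open>Before the explosion time the path is real and continuous, so the integrand of the drift is continuous at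
positive times and the drift is differentiable there.\<close>

lemma solution_path_drift:
  assumes sol: "solution_path a b \<xi> i T x"
    and a: "continuous_on {0<..} a" "\<And>t. t > 0 \<Longrightarrow> a t > 0"
    and b: "continuous_on UNIV b" "\<And>x. b x \<ge> 0"
  obtains D where
    "\<And>t. 0 \<le> t \<Longrightarrow> ereal t < T \<Longrightarrow> x t = ereal (\<xi> + D t + i t)"
    "\<And>t. 0 < t \<Longrightarrow> ereal t < T \<Longrightarrow> (D has_real_derivative a t * b (real_of_ereal (x t))) (at t)"
    "\<And>t. D t \<ge> 0"
proof
  define D where "D = (\<lambda>t. LINT s:{0<..t}|lebesgue. a s * b (real_of_ereal (x s)))"
  show x: "x t = ereal (\<xi> + D t + i t)" if "0 \<le> t" "ereal t < T" for t
    using sol that by (auto simp: solution_path_def D_def)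
  have isCont_x: "isCont (\<lambda>s. real_of_ereal (x s)) t" if t: "0 < t" "ereal t < T" for t
  proof -
    obtain t1 where t1: "t < t1" "ereal t1 < T"
      using ereal_dense2[OF t(2)] by auto
    have mem: "0 \<le> s \<and> ereal s \<le> T" if "0 < s" "s < t1" for s
    proof -
      have "ereal s \<le> ereal t1" using that by simp
      also have "\<dots> \<le> T" using t1(2) by (rule less_imp_le)
      finally show ?thesis using that by simp
    qed
    have "continuous_on {t. 0 \<le> t \<and> ereal t \<le> T} x"
      using sol by (simp only: solution_path_def)
    then have "continuous_on {0<..<t1} x"
      by (rule continuous_on_subset) (use mem in auto)
    then have "isCont x t"
      using t t1 by (simp add: continuous_on_eq_continuous_at)
    then have "(x \<longlongrightarrow> ereal (\<xi> + D t + i t)) (at t)"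
      using x[of t] t by (simp add: isCont_def)
    then have "((\<lambda>s. real_of_ereal (x s)) \<longlongrightarrow> \<xi> + D t + i t) (at t)"
      by (rule lim_real_of_ereal)
    then show ?thesis
      using x[of t] t by (simp add: isCont_def)
  qed
  show "(D has_real_derivative a t * b (real_of_ereal (x t))) (at t)" if "0 < t" "ereal t < T" for t
    unfolding D_def
  proof (rule set_integral_upper_limit_has_derivative[of T])
    fix s assume s: "0 < s" "ereal s < T"
    have "isCont a s" using a(1) s by (simp add: continuous_on_eq_continuous_at)
    moreover have "isCont b y" for y using b(1) by (simp add: continuous_on_eq_continuous_at)
    ultimately show "isCont (\<lambda>s. a s * b (real_of_ereal (x s))) s"
      by (intro isCont_mult isCont_o2[OF isCont_x[OF s], of b])
  next
    fix s assume "0 \<le> s" "ereal s < T"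
    then show "set_integrable lebesgue {0<..s} (\<lambda>s. a s * b (real_of_ereal (x s)))"
      using sol by (auto simp: solution_path_def)
  qed (use that in auto)
  show "D t \<ge> 0" for t
    unfolding D_def set_lebesgue_integral_def
    by (rule integral_nonneg_AE) (auto simp: a(2) b(2) less_imp_le split: split_indicator)
qed

text \<open>At a finite explosion time the path has an infinite limit. It is bounded below by \<open>\<xi> + i\<close>, so the limit is
\<open>+\<infinity>\<close>, and the comparison with the clock \<open>G\<close> applies.\<close>

lemma osgood_divergent_imp_no_explosion:
  assumes sol: "solution_path a b \<xi> i T x" and T: "0 \<le> T"
    and i: "continuous_on {0..} i"
    and a: "continuous_on {0<..} a" "\<And>t. t > 0 \<Longrightarrow> a t > 0"
    and b: "continuous_on UNIV b" "\<And>x. b x \<ge> 0" "\<And>x. x \<ge> r \<Longrightarrow> b x > 0" "mono_on {r..} b"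
    and G: "\<And>y. (G has_real_derivative 1 / b (max r y)) (at y)" and "\<not> (\<exists>B. \<forall>y. G y \<le> B)"
  shows "T = \<infinity>"
proof (rule ccontr)
  assume "T \<noteq> \<infinity>"
  then obtain T' where T': "T = ereal T'" "0 \<le> T'"
    using T by (cases T) auto
  obtain D where D:
    "\<And>t. 0 \<le> t \<Longrightarrow> ereal t < T \<Longrightarrow> x t = ereal (\<xi> + D t + i t)"
    "\<And>t. 0 < t \<Longrightarrow> ereal t < T \<Longrightarrow> (D has_real_derivative a t * b (real_of_ereal (x t))) (at t)"
    "\<And>t. D t \<ge> 0"
    using solution_path_drift[OF sol a b(1,2)] by metis
  have xT: "x T' \<notin> range ereal" using sol T' by (auto simp: solution_path_def)
  have pos: "0 < T'"
    using sol T' xT by (cases "T' = 0") (auto simp: solution_path_def)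
  have i': "continuous_on {0..T'} i" using i by (rule continuous_on_subset) auto
  have "\<exists>C. \<forall>t\<in>{0..T'}. \<bar>i t\<bar> \<le> C"
    using compact_imp_bounded[OF compact_continuous_image[OF i' compact_Icc]]
    by (auto simp: bounded_real)
  then obtain C where C: "\<And>t. t \<in> {0..T'} \<Longrightarrow> \<bar>i t\<bar> \<le> C" by blast
  have "continuous_on {t. 0 \<le> t \<and> ereal t \<le> T} x"
    using sol by (simp only: solution_path_def)
  then have "continuous_on {0..T'} x"
    by (rule continuous_on_subset) (simp add: T' subset_eq)
  then have "\<forall>t\<in>{0..T'}. (x \<longlongrightarrow> x t) (at t within {0..T'})"
    by (simp only: continuous_on_def)
  then have "(x \<longlongrightarrow> x T') (at T' within {0..T'})"
    using pos by simp
  then have lim: "(x \<longlongrightarrow> x T') (at_left T')"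
    using pos by (simp add: at_within_Icc_at_left)
  have near: "\<forall>\<^sub>F t in at_left T'. t \<in> {0<..<T'}"
    by (rule eventually_at_left_real[OF pos])
  have "ereal (\<xi> - C) \<le> x T'"
  proof (rule tendsto_lowerbound[OF lim])
    show "\<forall>\<^sub>F t in at_left T'. ereal (\<xi> - C) \<le> x t"
      using near
    proof eventually_elim
      case (elim t)
      then show ?case
        using D(1)[of t] D(3)[of t] C[of t] T' by auto
    qed
  qed (simp add: trivial_limit_at_left_real)
  then have "x T' = \<infinity>"
    using xT by (cases "x T'") auto
  then have ev: "\<forall>\<^sub>F t in at_left T'. ereal z < x t" for z
    using lim by (simp add: tendsto_PInfty)
  have "filterlim (\<lambda>t. real_of_ereal (x t)) at_top (at_left T')"
    unfolding filterlim_at_top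
  proof
    fix z
    show "\<forall>\<^sub>F t in at_left T'. z \<le> real_of_ereal (x t)"
      using near ev[of z]
    proof eventually_elim
      case (elim t)
      then show ?case using D(1)[of t] T' by auto
    qed
  qed
  then have "\<exists>B. \<forall>y. G y \<le> B"
    using D T'
    by (intro explosion_imp_osgood_bounded[OF b G a pos i', of "\<lambda>t. real_of_ereal (x t)" \<xi> D]) auto
  with assms show False by blast
qed

lemma global_solution_path_clock:
  assumes sol: "solution_path a b \<xi> i \<infinity> x"
    and a: "continuous_on {0<..} a" "\<And>t. t > 0 \<Longrightarrow> a t > 0"
      "\<And>t. t > 0 \<Longrightarrow> (A has_real_derivative a t) (at t)"
    and b: "continuous_on UNIV b" "\<And>x. b x \<ge> 0" "\<And>x. x \<ge> r \<Longrightarrow> b x > 0" "mono_on {r..} b"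
    and G: "\<And>y. (G has_real_derivative 1 / b (max r y)) (at y)" "\<And>y. G y \<le> B"
  shows "\<exists>H. clock_above A i (r - \<xi>) H \<and> (\<forall>t. H t \<le> B)"
proof -
  obtain D where D:
    "\<And>t. 0 \<le> t \<Longrightarrow> ereal t < \<infinity> \<Longrightarrow> x t = ereal (\<xi> + D t + i t)"
    "\<And>t. 0 < t \<Longrightarrow> ereal t < \<infinity> \<Longrightarrow> (D has_real_derivative a t * b (real_of_ereal (x t))) (at t)"
    "\<And>t. D t \<ge> 0"
    using solution_path_drift[OF sol a(1,2) b(1,2)] by metis
  have "clock_above A i (r - \<xi>) (\<lambda>t. G (r + D t))"
    using D
    by (intro global_solution_clock[OF b(2-4) G(1) a(2,3), of "\<lambda>t. real_of_ereal (x t)"]) auto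
  then show ?thesis using G(2) by blast
qed

section \<open>Integrals of step functions\<close>

text \<open>Writing an increment between two grid points as a sum over all grid cells, with the cells outside dropped by
a condition, lets intervals that overlap arbitrarily be refined to one common grid.\<close>

lemma sorted_telescope:
  fixes g :: "real \<Rightarrow> real"
  assumes xs: "sorted_wrt (<) xs" and u: "u \<in> set xs" and v: "v \<in> set xs" and uv: "u \<le> v"
  shows "g v - g u =
    (\<Sum>j<length xs - 1. if u \<le> xs ! j \<and> xs ! j < v then g (xs ! Suc j) - g (xs ! j) else 0)"
proof -
  obtain p where p: "p < length xs" "xs ! p = u" using u by (auto simp: in_set_conv_nth)
  obtain q where q: "q < length xs" "xs ! q = v" using v by (auto simp: in_set_conv_nth)
  have lt_iff: "xs ! i < xs ! j \<longleftrightarrow> i < j" if "i < length xs" "j < length xs" for i j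
    using sorted_wrt_nth_less[OF xs] that by (metis less_asym linorder_neqE_nat)
  have le_iff: "xs ! i \<le> xs ! j \<longleftrightarrow> i \<le> j" if "i < length xs" "j < length xs" for i j
    using lt_iff[OF that(2,1)] by (simp add: not_less[symmetric])
  have pq: "p \<le> q" using le_iff[OF p(1) q(1)] p q uv by simp
  have set: "{..<length xs - 1} \<inter> {j. u \<le> xs ! j \<and> xs ! j < v} = {p..<q}"
  proof (intro set_eqI iffI)
    fix j assume "j \<in> {..<length xs - 1} \<inter> {j. u \<le> xs ! j \<and> xs ! j < v}"
    then show "j \<in> {p..<q}" using lt_iff[of j q] le_iff[of p j] p q by auto
  next
    fix j assume "j \<in> {p..<q}"
    then show "j \<in> {..<length xs - 1} \<inter> {j. u \<le> xs ! j \<and> xs ! j < v}"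
      using lt_iff[of j q] le_iff[of p j] p q by auto
  qed
  have "(\<Sum>j<length xs - 1. if u \<le> xs ! j \<and> xs ! j < v then g (xs ! Suc j) - g (xs ! j) else 0) =
      (\<Sum>j\<in>{p..<q}. g (xs ! Suc j) - g (xs ! j))"
    by (subst sum.inter_restrict[symmetric, where B = "{j. u \<le> xs ! j \<and> xs ! j < v}", simplified])
      (simp_all add: set[symmetric])
  also have "\<dots> = g v - g u"
    using sum_Suc_diff'[OF pq, of "\<lambda>j. g (xs ! j)"] p q by simp
  finally show ?thesis by simp
qed

definition step_endpoints :: "(real \<times> real \<times> real) list \<Rightarrow> real set" where
  "step_endpoints ps = (\<Union>(c, u, v)\<in>set ps. {u, v})"

text \<open>The value of the step function on the grid cell whose left end point is \<open>s\<close>.\<close>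

definition step_coeff :: "(real \<times> real \<times> real) list \<Rightarrow> real \<Rightarrow> real" where
  "step_coeff ps s = (\<Sum>(c, u, v)\<leftarrow>ps. if u \<le> s \<and> s < v then c else 0)"

lemma finite_step_endpoints [simp]: "finite (step_endpoints ps)"
  by (auto simp: step_endpoints_def)

text \<open>One statement serves both the integral (\<open>g = W\<close>) and the step function itself, for which
\<open>g\<close> is minus the indicator of \<open>{..<s}\<close>.\<close>

lemma step_sum_on_grid:
  fixes g :: "real \<Rightarrow> real"
  assumes xs: "sorted_wrt (<) xs" and "step_endpoints ps \<subseteq> set xs"
    and "\<forall>(c, u, v)\<in>set ps. u \<le> v"
  shows "(\<Sum>(c, u, v)\<leftarrow>ps. c * (g v - g u)) =
    (\<Sum>j<length xs - 1. step_coeff ps (xs ! j) * (g (xs ! Suc j) - g (xs ! j)))"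
  using assms(2,3)
proof (induction ps)
  case Nil
  then show ?case by (simp add: step_coeff_def)
next
  case (Cons p ps)
  obtain c u v where p: "p = (c, u, v)" by (cases p)
  have "u \<in> set xs" "v \<in> set xs" "u \<le> v"
    using Cons.prems by (auto simp: p step_endpoints_def)
  from sorted_telescope[OF xs this, of g]
  have "c * (g v - g u) = (\<Sum>j<length xs - 1.
      (if u \<le> xs ! j \<and> xs ! j < v then c else 0) * (g (xs ! Suc j) - g (xs ! j)))"
    by (simp add: sum_distrib_left if_distrib if_distribR cong: if_cong)
  moreover have "(\<Sum>(c, u, v)\<leftarrow>ps. c * (g v - g u)) =
      (\<Sum>j<length xs - 1. step_coeff ps (xs ! j) * (g (xs ! Suc j) - g (xs ! j)))"
    using Cons by (auto simp: step_endpoints_def)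
  ultimately show ?case
    by (simp add: p step_coeff_def distrib_right sum.distrib)
qed

lemma step_integral_on_grid:
  assumes "sorted_wrt (<) xs" and "step_endpoints ps \<subseteq> set xs"
    and "\<forall>(c, u, v)\<in>set ps. u \<le> v"
  shows "step_integral W ps \<omega> =
    (\<Sum>j<length xs - 1. step_coeff ps (xs ! j) * (W (xs ! Suc j) \<omega> - W (xs ! j) \<omega>))"
  unfolding step_integral_def by (rule step_sum_on_grid[OF assms])

lemma step_fun_on_grid:
  assumes xs: "sorted_wrt (<) xs" and "step_endpoints ps \<subseteq> set xs"
    and le: "\<forall>(c, u, v)\<in>set ps. u \<le> v"
  shows "step_fun ps s =
    (\<Sum>j<length xs - 1. step_coeff ps (xs ! j) * indicator {xs ! j<..xs ! Suc j} s)"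
proof -
  let ?g = "\<lambda>u. - of_bool (u < s) :: real"
  have ind: "indicator {u<..v} s = ?g v - ?g u" if "u \<le> v" for u v
    using that by (auto simp: indicator_def)
  have "step_fun ps s = (\<Sum>(c, u, v)\<leftarrow>ps. c * (?g v - ?g u))"
    unfolding step_fun_def using le
    by (intro arg_cong[where f = sum_list] map_cong) (auto simp: indicator_def)
  also have "\<dots> = (\<Sum>j<length xs - 1. step_coeff ps (xs ! j) * (?g (xs ! Suc j) - ?g (xs ! j)))"
    by (rule step_sum_on_grid[OF assms])
  also have "\<dots> = (\<Sum>j<length xs - 1. step_coeff ps (xs ! j) * indicator {xs ! j<..xs ! Suc j} s)"
    using sorted_wrt_nth_less[OF xs] by (intro sum.cong refl arg_cong2[where f = times] ind[symmetric])
      (auto intro!: less_imp_le)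
  finally show ?thesis .
qed

lemma square_sum_orthogonal:
  fixes x :: "'i \<Rightarrow> real"
  assumes "finite A" and "\<And>i j. i \<in> A \<Longrightarrow> j \<in> A \<Longrightarrow> i \<noteq> j \<Longrightarrow> x i * x j = 0"
  shows "(\<Sum>i\<in>A. x i)\<^sup>2 = (\<Sum>i\<in>A. (x i)\<^sup>2)"
  using assms
proof (induction rule: finite_induct)
  case (insert i A)
  have "x i * (\<Sum>j\<in>A. x j) = 0"
    unfolding sum_distrib_left using insert.hyps insert.prems by (intro sum.neutral) auto
  then show ?case using insert by (simp add: power2_sum)
qed simp

lemma nn_integral_step_fun_square:
  assumes xs: "sorted_wrt (<) xs" and ends: "step_endpoints ps \<subseteq> set xs"
    and le: "\<forall>(c, u, v)\<in>set ps. u \<le> v"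
  shows "(\<integral>\<^sup>+s. ennreal ((step_fun ps s)\<^sup>2) \<partial>lebesgue) =
    ennreal (\<Sum>j<length xs - 1. (step_coeff ps (xs ! j))\<^sup>2 * (xs ! Suc j - xs ! j))"
proof -
  let ?n = "length xs - 1" and ?c = "\<lambda>j. step_coeff ps (xs ! j)"
  have mono: "xs ! i \<le> xs ! j" if "i \<le> j" "j < length xs" for i j
    using sorted_wrt_nth_less[OF xs, of i j] that by (cases "i = j") auto
  have eq: "(step_fun ps s)\<^sup>2 = (\<Sum>j<?n. (?c j)\<^sup>2 * indicator {xs ! j<..xs ! Suc j} s)" for s
  proof -
    have "(step_fun ps s)\<^sup>2 = (\<Sum>j<?n. (?c j * indicator {xs ! j<..xs ! Suc j} s)\<^sup>2)"
      unfolding step_fun_on_grid[OF assms]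
    proof (rule square_sum_orthogonal)
      fix i j assume ij: "i \<in> {..<?n}" "j \<in> {..<?n}" "i \<noteq> j"
      then have "xs ! Suc i \<le> xs ! j \<or> xs ! Suc j \<le> xs ! i"
        using mono[of "Suc i" j] mono[of "Suc j" i] by force
      then have "indicator {xs ! i<..xs ! Suc i} s * indicator {xs ! j<..xs ! Suc j} s = (0::real)"
        by (auto simp: indicator_def)
      then show "?c i * indicator {xs ! i<..xs ! Suc i} s * (?c j * indicator {xs ! j<..xs ! Suc j} s) = 0"
        by auto
    qed simp
    also have "\<dots> = (\<Sum>j<?n. (?c j)\<^sup>2 * indicator {xs ! j<..xs ! Suc j} s)"
      by (intro sum.cong) (auto split: split_indicator)
    finally show ?thesis .
  qed
  have "(\<integral>\<^sup>+s. ennreal ((step_fun ps s)\<^sup>2) \<partial>lebesgue) =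
      (\<integral>\<^sup>+s. (\<Sum>j<?n. ennreal ((?c j)\<^sup>2) * indicator {xs ! j<..xs ! Suc j} s) \<partial>lebesgue)"
  proof (intro nn_integral_cong)
    fix s
    have "ennreal (\<Sum>j<?n. (?c j)\<^sup>2 * indicator {xs ! j<..xs ! Suc j} s) =
        (\<Sum>j<?n. ennreal ((?c j)\<^sup>2 * indicator {xs ! j<..xs ! Suc j} s))"
      by (intro sum_ennreal[symmetric]) auto
    also have "\<dots> = (\<Sum>j<?n. ennreal ((?c j)\<^sup>2) * indicator {xs ! j<..xs ! Suc j} s)"
      by (intro sum.cong refl) (simp add: ennreal_mult ennreal_indicator)
    finally show "ennreal ((step_fun ps s)\<^sup>2) =
        (\<Sum>j<?n. ennreal ((?c j)\<^sup>2) * indicator {xs ! j<..xs ! Suc j} s)"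
      using eq by simp
  qed
  also have "\<dots> = (\<Sum>j<?n. ennreal ((?c j)\<^sup>2) * emeasure lebesgue {xs ! j<..xs ! Suc j})"
    by (subst nn_integral_sum) (auto simp: nn_integral_cmult_indicator
        intro!: borel_measurable_times_ennreal borel_measurable_indicator)
  also have "\<dots> = (\<Sum>j<?n. ennreal ((?c j)\<^sup>2 * (xs ! Suc j - xs ! j)))"
    using mono by (intro sum.cong refl) (auto simp: ennreal_mult)
  also have "\<dots> = ennreal (\<Sum>j<?n. (?c j)\<^sup>2 * (xs ! Suc j - xs ! j))"
    using mono by (intro sum_ennreal) auto
  finally show ?thesis .
qed

context brownian_motion
begin

lemma step_integral_measurable:
  assumes "step_list t ps"
  shows "step_integral W ps \<in> borel_measurable P"
  using assms
proof (induction ps)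
  case (Cons p ps)
  obtain c u v where p: "p = (c, u, v)" by (cases p)
  have [measurable]: "W u \<in> borel_measurable P" "W v \<in> borel_measurable P"
      "step_integral W ps \<in> borel_measurable P"
    using Cons by (auto simp: step_list_def p intro!: W_measurable)
  have "step_integral W (p # ps) = (\<lambda>\<omega>. c * (W v \<omega> - W u \<omega>) + step_integral W ps \<omega>)"
    by (auto simp: step_integral_def p)
  then show ?case by simp
qed (simp add: step_integral_def[abs_def])

text \<open>On a common grid the integral is a linear combination of independent centred normal increments whose
variances add up to the squared norm of the step function. Cells with coefficient \<open>0\<close> have to be
left out, as a normal density needs positive variance. The degenerate case \<open>\<sigma> = 0\<close> is kept apart for the
same reason.\<close>

lemma step_integral_normal:
  assumes ps: "step_list t ps"
  obtains \<sigma> where "\<sigma> \<ge> 0" "(\<integral>\<^sup>+s. ennreal ((step_fun ps s)\<^sup>2) \<partial>lebesgue) = ennreal (\<sigma>\<^sup>2)"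
    "\<sigma> = 0 \<Longrightarrow> step_integral W ps = (\<lambda>\<omega>. 0)"
    "\<sigma> > 0 \<Longrightarrow> distributed P lborel (step_integral W ps) (normal_density 0 \<sigma>)"
proof
  \<comment> \<open>All end points form the grid; \<open>J\<close> collects its cells with a non-zero coefficient.\<close>
  define xs where "xs = sorted_list_of_set (step_endpoints ps)"
  have xs: "sorted_wrt (<) xs" "set xs = step_endpoints ps"
    by (auto simp: xs_def)
  have le: "\<forall>(c, u, v)\<in>set ps. u \<le> v" and nonneg: "\<And>u. u \<in> set xs \<Longrightarrow> 0 \<le> u"
    using ps by (auto simp: xs(2) step_list_def step_endpoints_def)
  let ?n = "length xs - 1"
  define c where "c j = step_coeff ps (xs ! j)" for j
  define \<delta> where "\<delta> j = xs ! Suc j - xs ! j" for j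
  define \<Delta> where "\<Delta> j \<omega> = W (xs ! Suc j) \<omega> - W (xs ! j) \<omega>" for j \<omega>
  define J where "J = {j. j < ?n \<and> c j \<noteq> 0}"
  define \<sigma> where "\<sigma> = sqrt (\<Sum>j<?n. (c j)\<^sup>2 * \<delta> j)"
  have \<delta>: "0 < \<delta> j" if "j < ?n" for j
    using sorted_wrt_nth_less[OF xs(1), of j "Suc j"] that by (simp add: \<delta>_def)
  have sum0: "0 \<le> (\<Sum>j<?n. (c j)\<^sup>2 * \<delta> j)"
    by (intro sum_nonneg mult_nonneg_nonneg) (auto intro!: less_imp_le \<delta>)
  then show "\<sigma> \<ge> 0" by (simp add: \<sigma>_def)
  show "(\<integral>\<^sup>+s. ennreal ((step_fun ps s)\<^sup>2) \<partial>lebesgue) = ennreal (\<sigma>\<^sup>2)"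
    using nn_integral_step_fun_square[OF xs(1) _ le] sum0 by (simp add: xs(2) \<sigma>_def c_def \<delta>_def)
  have integral: "step_integral W ps = (\<lambda>\<omega>. \<Sum>j\<in>J. c j * \<Delta> j \<omega>)"
  proof
    fix \<omega>
    have "step_integral W ps \<omega> = (\<Sum>j<?n. c j * \<Delta> j \<omega>)"
      using step_integral_on_grid[OF xs(1) _ le] by (simp add: xs(2) c_def \<Delta>_def)
    also have "\<dots> = (\<Sum>j\<in>J. c j * \<Delta> j \<omega>)"
      by (rule sum.mono_neutral_right) (auto simp: J_def)
    finally show "step_integral W ps \<omega> = (\<Sum>j\<in>J. c j * \<Delta> j \<omega>)" .
  qed
  have \<sigma>J: "\<sigma> = sqrt (\<Sum>j\<in>J. (\<bar>c j\<bar> * sqrt (\<delta> j))\<^sup>2)"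
  proof -
    have "(\<Sum>j<?n. (c j)\<^sup>2 * \<delta> j) = (\<Sum>j\<in>J. (c j)\<^sup>2 * \<delta> j)"
      by (rule sum.mono_neutral_right) (auto simp: J_def)
    also have "\<dots> = (\<Sum>j\<in>J. (\<bar>c j\<bar> * sqrt (\<delta> j))\<^sup>2)"
      using \<delta> by (intro sum.cong) (auto simp: J_def power_mult_distrib less_imp_le)
    finally show ?thesis by (simp add: \<sigma>_def)
  qed
  have finJ: "finite J" by (simp add: J_def)
  have posJ: "0 < \<bar>c j\<bar> * sqrt (\<delta> j)" if "j \<in> J" for j
    using \<delta> that by (auto simp: J_def)
  show "step_integral W ps = (\<lambda>\<omega>. 0)" if "\<sigma> = 0"
  proof -
    have "J = {}"
    proof (rule ccontr)
      assume "J \<noteq> {}"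
      then have "0 < (\<Sum>j\<in>J. (\<bar>c j\<bar> * sqrt (\<delta> j))\<^sup>2)"
        using finJ by (intro sum_pos zero_less_power posJ)
      then show False using that \<sigma>J by simp
    qed
    then show ?thesis by (simp add: integral)
  qed
  show "distributed P lborel (step_integral W ps) (normal_density 0 \<sigma>)" if "\<sigma> > 0"
  proof -
    have ne: "J \<noteq> {}" using that \<sigma>J by auto
    then have "xs \<noteq> []" by (auto simp: J_def)
    then have "0 \<le> xs ! 0" by (intro nonneg) auto
    then have "indep_vars (\<lambda>_. borel) \<Delta> {..<?n}"
      unfolding \<Delta>_def using sorted_wrt_nth_less[OF xs(1)]
      by (intro W_indep[of "\<lambda>i. xs ! i" ?n]) auto
    then have "indep_vars (\<lambda>_. borel) \<Delta> J"
      by (rule indep_vars_subset) (auto simp: J_def)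
    then have "indep_vars (\<lambda>_. borel) (\<lambda>j \<omega>. c j * \<Delta> j \<omega>) J"
      by (rule indep_vars_compose2) simp
    moreover have "distributed P lborel (\<lambda>\<omega>. c j * \<Delta> j \<omega>) (normal_density 0 (\<bar>c j\<bar> * sqrt (\<delta> j)))"
      if j: "j \<in> J" for j
    proof -
      have j': "j < ?n" "c j \<noteq> 0" using j by (auto simp: J_def)
      have "distributed P lborel (\<Delta> j) (normal_density 0 (sqrt (\<delta> j)))"
        unfolding \<Delta>_def \<delta>_def using \<delta>[OF j'(1)] j' by (intro W_normal nonneg) (auto simp: \<delta>_def)
      from normal_density_affine[OF this _ j'(2), of 0] \<delta>[OF j'(1)] show ?thesis by simp
    qed
    ultimately have "distributed P lborel (\<lambda>\<omega>. \<Sum>j\<in>J. c j * \<Delta> j \<omega>)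
        (normal_density (\<Sum>j\<in>J. 0) (sqrt (\<Sum>j\<in>J. (\<bar>c j\<bar> * sqrt (\<delta> j))\<^sup>2)))"
      by (intro sum_indep_normal finJ ne posJ)
    then show ?thesis by (simp add: integral \<sigma>J del: power_mult_distrib)
  qed
qed

lemma step_integral_isometry:
  assumes ps: "step_list t ps"
  shows "(\<integral>\<^sup>+\<omega>. ennreal ((step_integral W ps \<omega>)\<^sup>2) \<partial>P) = (\<integral>\<^sup>+s. ennreal ((step_fun ps s)\<^sup>2) \<partial>lebesgue)"
proof -
  from step_integral_normal[OF ps] obtain \<sigma> where \<sigma>: "\<sigma> \<ge> 0"
    "(\<integral>\<^sup>+s. ennreal ((step_fun ps s)\<^sup>2) \<partial>lebesgue) = ennreal (\<sigma>\<^sup>2)"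
    "\<sigma> = 0 \<Longrightarrow> step_integral W ps = (\<lambda>\<omega>. 0)"
    "\<sigma> > 0 \<Longrightarrow> distributed P lborel (step_integral W ps) (normal_density 0 \<sigma>)"
    by metis
  show ?thesis
  proof (cases "\<sigma> = 0")
    case True
    with \<sigma> show ?thesis by simp
  next
    case False
    with \<sigma>(1) have pos: "\<sigma> > 0" by simp
    note D = \<sigma>(4)[OF pos]
    have "expectation (step_integral W ps) = 0"
      using normal_distributed_expectation[OF pos D] .
    then have eq: "(\<integral>\<omega>. (step_integral W ps \<omega>)\<^sup>2 \<partial>P) = \<sigma>\<^sup>2"
      using normal_distributed_variance[OF pos D] by simp
    then have "integrable P (\<lambda>\<omega>. (step_integral W ps \<omega>)\<^sup>2)"
      using pos by (metis not_integrable_integral_eq power_not_zero less_irrefl)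
    then show ?thesis
      using eq \<sigma>(2) by (subst nn_integral_eq_integral) auto
  qed
qed

text \<open>Dividing by the standard deviation \<open>\<sigma> \<ge> C\<close> reduces the claim to \<open>P(Z \<ge> 1)\<close> for a standard normal
\<open>Z\<close>. The bound \<open>std_normal_density 2\<close> is the least value of the density on \<open>[1, 2]\<close>.\<close>

lemma step_integral_upper_tail:
  assumes ps: "step_list t ps" and C: "0 < C"
    and var: "ennreal (C\<^sup>2) \<le> (\<integral>\<^sup>+s. ennreal ((step_fun ps s)\<^sup>2) \<partial>lebesgue)"
  shows "std_normal_density 2 \<le> prob {\<omega> \<in> space P. C \<le> step_integral W ps \<omega>}"
proof -
  from step_integral_normal[OF ps] obtain \<sigma> where \<sigma>: "\<sigma> \<ge> 0"
    "(\<integral>\<^sup>+s. ennreal ((step_fun ps s)\<^sup>2) \<partial>lebesgue) = ennreal (\<sigma>\<^sup>2)"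
    "\<sigma> > 0 \<Longrightarrow> distributed P lborel (step_integral W ps) (normal_density 0 \<sigma>)"
    by metis
  have C\<sigma>: "C \<le> \<sigma>" using var \<sigma>(1,2) C by (simp add: power2_le_iff_abs_le)
  then have pos: "0 < \<sigma>" using C by simp
  let ?Z = "\<lambda>\<omega>. step_integral W ps \<omega> / \<sigma>"
  have [measurable]: "step_integral W ps \<in> borel_measurable P"
    by (rule step_integral_measurable[OF ps])
  have Z: "distributed P lborel ?Z std_normal_density"
    using \<sigma>(3)[OF pos] normal_standard_normal_convert[OF pos, of "step_integral W ps" 0] by simp
  have "ennreal (std_normal_density 2) = (\<integral>\<^sup>+x. ennreal (std_normal_density 2) * indicator {1..2::real} x \<partial>lborel)"
    by (simp add: nn_integral_cmult_indicator)
  also have "\<dots> \<le> (\<integral>\<^sup>+x. ennreal (std_normal_density x) * indicator {1..} x \<partial>lborel)"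
  proof (rule nn_integral_mono)
    fix x :: real
    show "ennreal (std_normal_density 2) * indicator {1..2} x \<le> ennreal (std_normal_density x) * indicator {1..} x"
    proof (cases "x \<in> {1..2}")
      case True
      then have "x\<^sup>2 \<le> 2\<^sup>2" by (intro power_mono) auto
      then have "std_normal_density 2 \<le> std_normal_density x"
        by (auto simp: std_normal_density_def intro!: divide_right_mono)
      then show ?thesis using True by (auto simp: ennreal_leI)
    qed auto
  qed
  also have "\<dots> = emeasure P (?Z -` {1..} \<inter> space P)"
    by (rule distributed_emeasure[OF Z, symmetric]) simp
  also have "\<dots> \<le> emeasure P {\<omega> \<in> space P. C \<le> step_integral W ps \<omega>}"
  proof (rule emeasure_mono)
    show "?Z -` {1..} \<inter> space P \<subseteq> {\<omega> \<in> space P. C \<le> step_integral W ps \<omega>}"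
      using pos C\<sigma> by (auto simp: field_simps)
  qed measurable
  finally show ?thesis
    by (simp add: emeasure_eq_measure)
qed

end

section \<open>Approximation of increments of a Wiener integral\<close>

text \<open>Represents the step function multiplied by the indicator of \<open>(s, t]\<close>. Moving the end points into
\<open>[s, t]\<close> turns the intervals outside into empty ones.\<close>

definition step_clip :: "real \<Rightarrow> real \<Rightarrow> (real \<times> real \<times> real) list \<Rightarrow> (real \<times> real \<times> real) list" where
  "step_clip s t ps = map (\<lambda>(c, u, v). (c, max s (min t u), max s (min t v))) ps"

lemma step_fun_clip: "step_fun (step_clip s t ps) x = step_fun ps x * indicator {s<..t} x"
proof (induction ps)
  case (Cons p ps)
  obtain c u v where p: "p = (c, u, v)" by (cases p)
  have "indicator {max s (min t u)<..max s (min t v)} x = (indicator {u<..v} x * indicator {s<..t} x :: real)"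
    by (auto simp: indicator_def)
  then show ?case
    using Cons by (simp add: p step_fun_def step_clip_def distrib_right)
qed (simp add: step_fun_def step_clip_def)

lemma step_clip_endpoints:
  assumes "\<forall>(c, u, v)\<in>set ps. u \<le> v" "s \<le> t"
  shows "\<forall>(c, u, v)\<in>set (step_clip s t ps). s \<le> u \<and> u \<le> v \<and> v \<le> t"
  using assms by (fastforce simp: step_clip_def)

lemma step_integral_split:
  assumes "step_list t ps" "0 \<le> s" "s \<le> t"
  shows "step_integral W ps \<omega> =
    step_integral W (step_clip 0 s ps) \<omega> + step_integral W (step_clip s t ps) \<omega>"
  using assms(1)
proof (induction ps)
  case (Cons p ps)
  obtain c u v where p: "p = (c, u, v)" by (cases p)
  have split: "W y \<omega> + W s \<omega> = W (max 0 (min s y)) \<omega> + W (max s (min t y)) \<omega>"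
    if "0 \<le> y" "y \<le> t" for y
    using that assms(2,3) by (auto simp: max_def min_def)
  have eq: "W v \<omega> - W u \<omega> = (W (max 0 (min s v)) \<omega> - W (max 0 (min s u)) \<omega>) +
      (W (max s (min t v)) \<omega> - W (max s (min t u)) \<omega>)"
  proof -
    have "0 \<le> u" "u \<le> v" "v \<le> t" using Cons.prems by (auto simp: step_list_def p)
    then show ?thesis using split[of u] split[of v] by linarith
  qed
  have "step_list t ps" using Cons.prems by (simp add: step_list_def p)
  from Cons.IH[OF this] show ?case
    unfolding p step_integral_def step_clip_def list.map sum_list.Cons prod.case
    by (simp only: eq distrib_left add_ac)
qed (simp add: step_integral_def step_clip_def)

lemma step_clip_id: "step_list s ps \<Longrightarrow> step_clip 0 s ps = ps"
  unfolding step_clip_def step_list_def by (intro map_idI) (auto simp: max_def min_def)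

lemma step_fun_append_neg:
  "step_fun (ps @ map (\<lambda>(c, u, v). (- c, u, v)) qs) x = step_fun ps x - step_fun qs x"
proof -
  have "step_fun (map (\<lambda>(c, u, v). (- c, u, v)) qs) x = - step_fun qs x"
    by (induction qs) (auto simp: step_fun_def)
  then show ?thesis by (simp add: step_fun_def)
qed

lemma step_integral_append_neg:
  "step_integral W (ps @ map (\<lambda>(c, u, v). (- c, u, v)) qs) \<omega> =
    step_integral W ps \<omega> - step_integral W qs \<omega>"
proof -
  have "step_integral W (map (\<lambda>(c, u, v). (- c, u, v)) qs) \<omega> = - step_integral W qs \<omega>"
    by (induction qs) (auto simp: step_integral_def)
  then show ?thesis by (simp add: step_integral_def)
qed

lemma step_fun_measurable [measurable]: "step_fun ps \<in> borel_measurable lebesgue"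
proof (induction ps)
  case (Cons p ps)
  obtain c u v where p: "p = (c, u, v)" by (cases p)
  have "step_fun (p # ps) = (\<lambda>x. c * indicator {u<..v} x + step_fun ps x)"
    by (auto simp: step_fun_def p)
  then show ?case
    using Cons by (auto intro!: borel_measurable_add borel_measurable_times borel_measurable_indicator)
qed (simp add: step_fun_def[abs_def])

lemma square_add_le: "(x + y)\<^sup>2 \<le> 2 * (x\<^sup>2 + y\<^sup>2)" for x y :: real
  using zero_le_power2[of "x - y"] by (simp add: power2_eq_square algebra_simps)

lemma square_add3_le: "(x + y + z)\<^sup>2 \<le> 3 * (x\<^sup>2 + y\<^sup>2 + z\<^sup>2)" for x y z :: real
  using zero_le_power2[of "x - y"] zero_le_power2[of "y - z"] zero_le_power2[of "x - z"]
  by (simp add: power2_eq_square algebra_simps)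

lemma wiener_integral_approx:
  assumes "wiener_integral P W f t Y" "0 < (\<epsilon>::real)"
  obtains ps where "step_list t ps"
    "(\<integral>\<^sup>+s\<in>{0..t}. ennreal ((f s - step_fun ps s)\<^sup>2) \<partial>lebesgue) \<le> ennreal \<epsilon>"
    "(\<integral>\<^sup>+\<omega>. ennreal ((Y \<omega> - step_integral W ps \<omega>)\<^sup>2) \<partial>P) \<le> ennreal \<epsilon>"
proof -
  obtain ps where ps: "\<forall>n::nat. step_list t (ps n)"
      "(\<lambda>n. \<integral>\<^sup>+s\<in>{0..t}. ennreal ((f s - step_fun (ps n) s)\<^sup>2) \<partial>lebesgue) \<longlonglongrightarrow> 0"
      "(\<lambda>n. \<integral>\<^sup>+\<omega>. ennreal ((Y \<omega> - step_integral W (ps n) \<omega>)\<^sup>2) \<partial>P) \<longlonglongrightarrow> 0"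
    using assms(1) by (auto simp: wiener_integral_def)
  have "0 < ennreal \<epsilon>" using assms(2) by simp
  then have "\<forall>\<^sub>F n in sequentially.
      (\<integral>\<^sup>+s\<in>{0..t}. ennreal ((f s - step_fun (ps n) s)\<^sup>2) \<partial>lebesgue) < ennreal \<epsilon> \<and>
      (\<integral>\<^sup>+\<omega>. ennreal ((Y \<omega> - step_integral W (ps n) \<omega>)\<^sup>2) \<partial>P) < ennreal \<epsilon>"
    by (intro eventually_conj order_tendstoD(2)[OF ps(2)] order_tendstoD(2)[OF ps(3)])
  then obtain n where
    "(\<integral>\<^sup>+s\<in>{0..t}. ennreal ((f s - step_fun (ps n) s)\<^sup>2) \<partial>lebesgue) < ennreal \<epsilon>"
    "(\<integral>\<^sup>+\<omega>. ennreal ((Y \<omega> - step_integral W (ps n) \<omega>)\<^sup>2) \<partial>P) < ennreal \<epsilon>"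
    by (auto simp: eventually_sequentially)
  then show ?thesis using that[of "ps n"] ps(1) by (auto intro: less_imp_le)
qed

text \<open>The approximations of \<open>Y\<^sub>s\<close> and of \<open>Y\<^sub>t\<close> are unrelated step functions \<open>q\<close> and \<open>p\<close>. The part of
\<open>p\<close> after \<open>s\<close> approximates the increment: the part before \<open>s\<close> and \<open>q\<close> are both close to \<open>f\<close> on
\<open>[0, s]\<close>, so by the isometry their integrals almost cancel. What matters is that only the increments
of \<open>W\<close> after time \<open>s\<close> enter; this is where independence comes from. The bound on the norm of \<open>f\<close>
keeps the variance of the approximation large when that of the increment is large.\<close>

lemma (in brownian_motion) wiener_increment_approx:
  fixes f :: "real \<Rightarrow> real"
  assumes f [measurable]: "f \<in> borel_measurable lebesgue"
    and Ys: "wiener_integral P W f s Ys" and Yt: "wiener_integral P W f t Yt"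
    and st: "0 \<le> s" "s \<le> t" and \<delta>: "0 < (\<delta>::real)"
  obtains ps where "\<forall>(c, u, v)\<in>set ps. s \<le> u \<and> u \<le> v \<and> v \<le> t"
    "(\<integral>\<^sup>+x\<in>{s<..t}. ennreal ((f x)\<^sup>2) \<partial>lebesgue) \<le>
      2 * (ennreal \<delta> + (\<integral>\<^sup>+x. ennreal ((step_fun ps x)\<^sup>2) \<partial>lebesgue))"
    "(\<integral>\<^sup>+\<omega>. ennreal ((Yt \<omega> - Ys \<omega> - step_integral W ps \<omega>)\<^sup>2) \<partial>P) \<le> ennreal \<delta>"
proof -
  \<comment> \<open>The error splits into three parts with squared norms at most \<open>\<epsilon>\<close>, \<open>4 \<epsilon>\<close>, \<open>\<epsilon>\<close>; squaring the sum costs a factor \<open>3\<close>.\<close>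
  define \<epsilon> where "\<epsilon> = \<delta> / 18"
  have \<epsilon>: "0 < \<epsilon>" "\<epsilon> \<le> \<delta>" using \<delta> by (auto simp: \<epsilon>_def)
  obtain p where p: "step_list t p"
    "(\<integral>\<^sup>+x\<in>{0..t}. ennreal ((f x - step_fun p x)\<^sup>2) \<partial>lebesgue) \<le> ennreal \<epsilon>"
    "(\<integral>\<^sup>+\<omega>. ennreal ((Yt \<omega> - step_integral W p \<omega>)\<^sup>2) \<partial>P) \<le> ennreal \<epsilon>"
    by (rule wiener_integral_approx[OF Yt \<epsilon>(1)])
  obtain q where q: "step_list s q"
    "(\<integral>\<^sup>+x\<in>{0..s}. ennreal ((f x - step_fun q x)\<^sup>2) \<partial>lebesgue) \<le> ennreal \<epsilon>"
    "(\<integral>\<^sup>+\<omega>. ennreal ((Ys \<omega> - step_integral W q \<omega>)\<^sup>2) \<partial>P) \<le> ennreal \<epsilon>"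
    by (rule wiener_integral_approx[OF Ys \<epsilon>(1)])
  define ps where "ps = step_clip s t p"
  \<comment> \<open>The difference of the two step functions that approximate \<open>f\<close> on \<open>[0, s]\<close>.\<close>
  define ds where "ds = step_clip 0 s p @ map (\<lambda>(c, u, v). (- c, u, v)) q"
  have ends_p: "\<forall>(c, u, v)\<in>set p. u \<le> v" using p(1) by (auto simp: step_list_def)
  have ends: "\<forall>(c, u, v)\<in>set ps. s \<le> u \<and> u \<le> v \<and> v \<le> t"
    unfolding ps_def by (rule step_clip_endpoints[OF ends_p st(2)])
  have ps: "step_list t ps"
    using ends st(1) unfolding step_list_def by (auto intro: order.trans)
  have ds: "step_list s ds"
    using step_clip_endpoints[OF ends_p st(1)] q(1) by (auto simp: step_list_def ds_def)
  have [measurable]: "Yt \<in> borel_measurable P" "Ys \<in> borel_measurable P"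
    using Yt Ys by (auto simp: wiener_integral_def)
  note [measurable] = step_integral_measurable[OF p(1)] step_integral_measurable[OF q(1)]
    step_integral_measurable[OF ps] step_integral_measurable[OF ds]
  have [measurable, simp]: "(\<lambda>x. ennreal ((f x - step_fun qs x)\<^sup>2) * indicator {0..y} x) \<in> borel_measurable lebesgue"
    for qs y
    by (intro borel_measurable_times_ennreal borel_measurable_indicator) auto
  have [simp]: "(\<lambda>x. ennreal ((step_fun qs x)\<^sup>2)) \<in> borel_measurable lebesgue" for qs
    by measurable
  have ds_fun: "(step_fun ds x)\<^sup>2 \<le> 2 * ((f x - step_fun p x)\<^sup>2 * indicator {0..t} x +
      (f x - step_fun q x)\<^sup>2 * indicator {0..s} x)" for x
  proof -
    have "step_fun q x = step_fun q x * indicator {0<..s} x"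
      using step_fun_clip[of 0 s q x] step_clip_id[OF q(1)] by simp
    then have "step_fun ds x = (step_fun p x - step_fun q x) * indicator {0<..s} x"
      unfolding ds_def step_fun_append_neg step_fun_clip by (auto simp: left_diff_distrib)
    then show ?thesis
      using square_add_le[of "step_fun p x - f x" "f x - step_fun q x"] st
      by (auto simp: indicator_def power2_commute[of "step_fun p x" "f x"])
  qed
  have "(\<integral>\<^sup>+\<omega>. ennreal ((step_integral W ds \<omega>)\<^sup>2) \<partial>P) = (\<integral>\<^sup>+x. ennreal ((step_fun ds x)\<^sup>2) \<partial>lebesgue)"
    by (rule step_integral_isometry[OF ds])
  also have "\<dots> \<le> (\<integral>\<^sup>+x. 2 * (ennreal ((f x - step_fun p x)\<^sup>2) * indicator {0..t} x +
      ennreal ((f x - step_fun q x)\<^sup>2) * indicator {0..s} x) \<partial>lebesgue)"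
  proof (rule nn_integral_mono)
    fix x
    have "ennreal ((step_fun ds x)\<^sup>2) \<le> ennreal (2 * ((f x - step_fun p x)\<^sup>2 * indicator {0..t} x +
        (f x - step_fun q x)\<^sup>2 * indicator {0..s} x))"
      by (rule ennreal_leI[OF ds_fun])
    also have "\<dots> = 2 * (ennreal ((f x - step_fun p x)\<^sup>2) * indicator {0..t} x +
      ennreal ((f x - step_fun q x)\<^sup>2) * indicator {0..s} x)"
      by (simp add: ennreal_mult ennreal_plus ennreal_indicator)
    finally show "ennreal ((step_fun ds x)\<^sup>2) \<le> \<dots>" .
  qed
  also have "\<dots> = 2 * ((\<integral>\<^sup>+x\<in>{0..t}. ennreal ((f x - step_fun p x)\<^sup>2) \<partial>lebesgue) +
      (\<integral>\<^sup>+x\<in>{0..s}. ennreal ((f x - step_fun q x)\<^sup>2) \<partial>lebesgue))"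
    by (simp add: nn_integral_cmult nn_integral_add)
  also have "\<dots> \<le> 2 * (ennreal \<epsilon> + ennreal \<epsilon>)"
    by (intro mult_left_mono add_mono p q) auto
  finally have ds_int: "(\<integral>\<^sup>+\<omega>. ennreal ((step_integral W ds \<omega>)\<^sup>2) \<partial>P) \<le> 2 * (ennreal \<epsilon> + ennreal \<epsilon>)" .
  have decomp: "Yt \<omega> - Ys \<omega> - step_integral W ps \<omega> =
      (Yt \<omega> - step_integral W p \<omega>) + step_integral W ds \<omega> + - (Ys \<omega> - step_integral W q \<omega>)" for \<omega>
    using step_integral_split[OF p(1) st, of W \<omega>]
    unfolding ds_def ps_def step_integral_append_neg by simp
  have "(\<integral>\<^sup>+\<omega>. ennreal ((Yt \<omega> - Ys \<omega> - step_integral W ps \<omega>)\<^sup>2) \<partial>P) \<le>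
      (\<integral>\<^sup>+\<omega>. 3 * (ennreal ((Yt \<omega> - step_integral W p \<omega>)\<^sup>2) +
        ennreal ((step_integral W ds \<omega>)\<^sup>2) + ennreal ((Ys \<omega> - step_integral W q \<omega>)\<^sup>2)) \<partial>P)"
  proof (rule nn_integral_mono)
    fix \<omega>
    have "ennreal ((Yt \<omega> - Ys \<omega> - step_integral W ps \<omega>)\<^sup>2) \<le>
      ennreal (3 * ((Yt \<omega> - step_integral W p \<omega>)\<^sup>2 + (step_integral W ds \<omega>)\<^sup>2 +
        (Ys \<omega> - step_integral W q \<omega>)\<^sup>2))"
      unfolding decomp
      using square_add3_le[of "Yt \<omega> - step_integral W p \<omega>" "step_integral W ds \<omega>"
          "- (Ys \<omega> - step_integral W q \<omega>)"]
      by (intro ennreal_leI) (simp only: power2_minus)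
    then show "ennreal ((Yt \<omega> - Ys \<omega> - step_integral W ps \<omega>)\<^sup>2) \<le>
        3 * (ennreal ((Yt \<omega> - step_integral W p \<omega>)\<^sup>2) + ennreal ((step_integral W ds \<omega>)\<^sup>2) +
          ennreal ((Ys \<omega> - step_integral W q \<omega>)\<^sup>2))"
      by (simp add: ennreal_mult ennreal_plus)
  qed
  also have "\<dots> = 3 * ((\<integral>\<^sup>+\<omega>. ennreal ((Yt \<omega> - step_integral W p \<omega>)\<^sup>2) \<partial>P) +
      (\<integral>\<^sup>+\<omega>. ennreal ((step_integral W ds \<omega>)\<^sup>2) \<partial>P) +
      (\<integral>\<^sup>+\<omega>. ennreal ((Ys \<omega> - step_integral W q \<omega>)\<^sup>2) \<partial>P))"
    by (simp add: nn_integral_cmult nn_integral_add)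
  also have "\<dots> \<le> 3 * (ennreal \<epsilon> + 2 * (ennreal \<epsilon> + ennreal \<epsilon>) + ennreal \<epsilon>)"
    by (intro mult_left_mono add_mono p q ds_int) auto
  also have "\<dots> = ennreal (3 * (\<epsilon> + 2 * (\<epsilon> + \<epsilon>) + \<epsilon>))"
  proof -
    have "3 * (e + 2 * (e + e) + e) = (3 * 1 + 3 * (2 * (1 + 1)) + 3 * 1) * e" for e :: ennreal
      by (simp only: distrib_left distrib_right mult.assoc mult_1_left mult_1_right)
    then show ?thesis
      using \<epsilon> by (simp add: ennreal_mult)
  qed
  also have "\<dots> = ennreal \<delta>" by (simp add: \<epsilon>_def)
  finally have second: "(\<integral>\<^sup>+\<omega>. ennreal ((Yt \<omega> - Ys \<omega> - step_integral W ps \<omega>)\<^sup>2) \<partial>P) \<le> ennreal \<delta>" .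
  have "(\<integral>\<^sup>+x\<in>{s<..t}. ennreal ((f x)\<^sup>2) \<partial>lebesgue) \<le>
      (\<integral>\<^sup>+x. 2 * (ennreal ((f x - step_fun p x)\<^sup>2) * indicator {0..t} x + ennreal ((step_fun ps x)\<^sup>2)) \<partial>lebesgue)"
  proof (rule nn_integral_mono)
    fix x
    have "(f x)\<^sup>2 * indicator {s<..t} x \<le> 2 * ((f x - step_fun p x)\<^sup>2 * indicator {0..t} x + (step_fun ps x)\<^sup>2)"
      using square_add_le[of "f x - step_fun p x" "step_fun p x"] st
      by (auto simp: indicator_def ps_def step_fun_clip)
    then have "ennreal ((f x)\<^sup>2 * indicator {s<..t} x) \<le>
        ennreal (2 * ((f x - step_fun p x)\<^sup>2 * indicator {0..t} x + (step_fun ps x)\<^sup>2))"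
      by (rule ennreal_leI)
    then show "ennreal ((f x)\<^sup>2) * indicator {s<..t} x \<le>
        2 * (ennreal ((f x - step_fun p x)\<^sup>2) * indicator {0..t} x + ennreal ((step_fun ps x)\<^sup>2))"
      by (simp add: ennreal_mult ennreal_plus ennreal_indicator)
  qed
  also have "\<dots> = 2 * ((\<integral>\<^sup>+x\<in>{0..t}. ennreal ((f x - step_fun p x)\<^sup>2) \<partial>lebesgue) +
      (\<integral>\<^sup>+x. ennreal ((step_fun ps x)\<^sup>2) \<partial>lebesgue))"
    by (simp add: nn_integral_cmult nn_integral_add)
  also have "\<dots> \<le> 2 * (ennreal \<delta> + (\<integral>\<^sup>+x. ennreal ((step_fun ps x)\<^sup>2) \<partial>lebesgue))"
    using \<epsilon> by (intro mult_left_mono add_mono order.trans[OF p(2)] ennreal_leI) auto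
  finally show ?thesis using that[OF ends _ second] by simp
qed

section \<open>Independence of events in disjoint time intervals\<close>

context brownian_motion
begin

text \<open>Events that depend on the values of \<open>W\<close> at finitely many times in \<open>[s, t]\<close>, taken relative to time
\<open>s\<close>.\<close>

definition increment_event :: "real \<Rightarrow> real \<Rightarrow> 'a set \<Rightarrow> bool" where
  "increment_event s t F \<longleftrightarrow> (\<exists>S Z. finite S \<and> S \<subseteq> {s..t} \<and> Z \<in> sets (PiM S (\<lambda>_. borel)) \<and>
    F = {\<omega> \<in> space P. restrict (\<lambda>u. W u \<omega> - W s \<omega>) S \<in> Z})"

text \<open>Independence is given for consecutive increments along a finite grid. For finitely many events all
the times involved are put on one grid that also contains the end points \<open>\<tau> k\<close>. Every event is then a
function of the increments over the grid cells in its own interval, and these groups of cells are disjoint.\<close>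

lemma increment_events_indep:
  fixes \<tau> :: "nat \<Rightarrow> real"
  assumes \<tau>0: "0 \<le> \<tau> 0" and \<tau>: "strict_mono \<tau>"
    and F: "\<And>k. increment_event (\<tau> k) (\<tau> (Suc k)) (F k)"
  shows "indep_events F UNIV"
proof -
  have "\<forall>k. \<exists>S Z. finite S \<and> S \<subseteq> {\<tau> k..\<tau> (Suc k)} \<and> Z \<in> sets (PiM S (\<lambda>_. borel)) \<and>
      F k = {\<omega> \<in> space P. restrict (\<lambda>u. W u \<omega> - W (\<tau> k) \<omega>) S \<in> Z}"
    using F by (simp only: increment_event_def simp_thms)
  from choice[OF this] obtain S where
    "\<forall>k. \<exists>Z. finite (S k) \<and> S k \<subseteq> {\<tau> k..\<tau> (Suc k)} \<and> Z \<in> sets (PiM (S k) (\<lambda>_. borel)) \<and>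
      F k = {\<omega> \<in> space P. restrict (\<lambda>u. W u \<omega> - W (\<tau> k) \<omega>) (S k) \<in> Z}" ..
  from choice[OF this] obtain Z where SZ:
    "\<forall>k. finite (S k) \<and> S k \<subseteq> {\<tau> k..\<tau> (Suc k)} \<and> Z k \<in> sets (PiM (S k) (\<lambda>_. borel)) \<and>
      F k = {\<omega> \<in> space P. restrict (\<lambda>u. W u \<omega> - W (\<tau> k) \<omega>) (S k) \<in> Z k}" ..
  then have S: "\<And>k. finite (S k)" "\<And>k. S k \<subseteq> {\<tau> k..\<tau> (Suc k)}"
    and Z: "\<And>k. Z k \<in> sets (PiM (S k) (\<lambda>_. borel))"
    and FZ: "\<And>k. F k = {\<omega> \<in> space P. restrict (\<lambda>u. W u \<omega> - W (\<tau> k) \<omega>) (S k) \<in> Z k}"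
    by blast+
  have \<tau>_le: "\<tau> j \<le> \<tau> k" if "j \<le> k" for j k
    using \<tau> that by (simp add: strict_mono_less_eq)
  have \<tau>_nonneg: "0 \<le> \<tau> k" for k using \<tau>0 \<tau>_le[of 0 k] by simp
  have W_meas: "W u \<in> borel_measurable P" if "u \<in> S k" for u k
    using S(2)[of k] that \<tau>_nonneg[of k] by (intro W_measurable) auto
  have F_events: "F k \<in> events" for k
  proof -
    have "(\<lambda>\<omega>. restrict (\<lambda>u. W u \<omega> - W (\<tau> k) \<omega>) (S k)) \<in> measurable P (PiM (S k) (\<lambda>_. borel))"
      by (intro measurable_restrict borel_measurable_diff W_meas[of _ k] W_measurable \<tau>_nonneg)
    from measurable_sets[OF this Z[of k]] show ?thesis
      unfolding FZ by (simp add: vimage_def Int_def conj_commute)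
  qed
  have prod: "prob (\<Inter>k\<in>J. F k) = (\<Prod>k\<in>J. prob (F k))" if J: "finite J" "J \<noteq> {}" for J
  proof -
    obtain N where N: "J \<subseteq> {..<N}" using finite_nat_bounded[OF J(1)] by blast
    define U where "U = (\<Union>k<N. S k \<union> {\<tau> k, \<tau> (Suc k)})"
    have finU: "finite U" using S(1) by (auto simp: U_def)
    define xs where "xs = sorted_list_of_set U"
    have xs: "sorted_wrt (<) xs" "set xs = U" using finU by (auto simp: xs_def)
    let ?n = "length xs - 1"
    define \<Delta> where "\<Delta> j \<omega> = W (xs ! Suc j) \<omega> - W (xs ! j) \<omega>" for j \<omega>
    have U_nonneg: "0 \<le> u" if "u \<in> U" for u
    proof -
      obtain k where "u \<in> S k \<union> {\<tau> k, \<tau> (Suc k)}" using \<open>u \<in> U\<close> by (auto simp: U_def)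
      then have "\<tau> k \<le> u" using S(2)[of k] \<tau>_le[of k "Suc k"] by auto
      then show ?thesis using \<tau>_nonneg[of k] by simp
    qed
    have "0 < N" using J N by auto
    then have "xs \<noteq> []" using xs(2) by (auto simp: U_def)
    then have "xs ! 0 \<in> U" using nth_mem[of 0 xs] xs(2) by simp
    then have indep: "indep_vars (\<lambda>_. borel) \<Delta> {..<?n}"
      unfolding \<Delta>_def using sorted_wrt_nth_less[OF xs(1)] U_nonneg
      by (intro W_indep[of "\<lambda>i. xs ! i" ?n]) auto
    define K where "K k = {j. j < ?n \<and> \<tau> k \<le> xs ! j \<and> xs ! j < \<tau> (Suc k)}" for k
    define h where "h k z = (\<lambda>u\<in>S k. \<Sum>j\<in>K k. if xs ! j < u then z j else (0::real))" for k z
    have disj: "disjoint_family_on K {..<N}"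
    proof -
      have "K j \<inter> K k = {}" if "j < k" for j k
        using \<tau>_le[of "Suc j" k] that by (auto simp: K_def)
      then show ?thesis unfolding disjoint_family_on_def by (metis Int_commute linorder_neqE_nat)
    qed
    have "indep_vars (\<lambda>k. PiM (K k) (\<lambda>_. borel)) (\<lambda>k \<omega>. restrict (\<lambda>j. \<Delta> j \<omega>) (K k)) {..<N}"
      by (rule indep_vars_restrict[OF indep _ disj]) (auto simp: K_def)
    then have "indep_vars (\<lambda>k. PiM (S k) (\<lambda>_. borel)) (\<lambda>k \<omega>. h k (restrict (\<lambda>j. \<Delta> j \<omega>) (K k))) {..<N}"
    proof (rule indep_vars_compose2)
      fix k
      have "(\<lambda>z. if xs ! j < u then z j else (0::real)) \<in> borel_measurable (PiM (K k) (\<lambda>_. borel))"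
        if "j \<in> K k" for j u
        using measurable_component_singleton[OF that, of "\<lambda>_. borel"] by (cases "xs ! j < u") auto
      then show "h k \<in> measurable (PiM (K k) (\<lambda>_. borel)) (PiM (S k) (\<lambda>_. borel))"
        unfolding h_def by (intro measurable_restrict borel_measurable_sum) auto
    qed
    from indep_varsD[OF this J(2,1) N, of Z]
    have "prob (\<Inter>k\<in>J. (\<lambda>\<omega>. h k (restrict (\<lambda>j. \<Delta> j \<omega>) (K k))) -` Z k \<inter> space P) =
        (\<Prod>k\<in>J. prob ((\<lambda>\<omega>. h k (restrict (\<lambda>j. \<Delta> j \<omega>) (K k))) -` Z k \<inter> space P))"
      using Z by auto
    moreover have "(\<lambda>\<omega>. h k (restrict (\<lambda>j. \<Delta> j \<omega>) (K k))) -` Z k \<inter> space P = F k" if k: "k \<in> J" for k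
    proof -
      have kN: "k < N" using N k by auto
      have "h k (restrict (\<lambda>j. \<Delta> j \<omega>) (K k)) = restrict (\<lambda>u. W u \<omega> - W (\<tau> k) \<omega>) (S k)" for \<omega>
        unfolding h_def
      proof (rule restrict_ext)
        fix u assume u: "u \<in> S k"
        then have mem: "\<tau> k \<in> set xs" "u \<in> set xs" and le: "\<tau> k \<le> u" "u \<le> \<tau> (Suc k)"
          using kN S(2)[of k] xs(2) by (auto simp: U_def)
        have "W u \<omega> - W (\<tau> k) \<omega> =
            (\<Sum>j<?n. if \<tau> k \<le> xs ! j \<and> xs ! j < u then \<Delta> j \<omega> else 0)"
          unfolding \<Delta>_def by (rule sorted_telescope[OF xs(1) mem le(1), of "\<lambda>u. W u \<omega>"])
        also have "\<dots> = (\<Sum>j\<in>K k. if xs ! j < u then restrict (\<lambda>j. \<Delta> j \<omega>) (K k) j else 0)"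
          using le by (intro sum.mono_neutral_cong_right) (auto simp: K_def)
        finally show "(\<Sum>j\<in>K k. if xs ! j < u then restrict (\<lambda>j. \<Delta> j \<omega>) (K k) j else 0) =
            W u \<omega> - W (\<tau> k) \<omega>" ..
      qed
      then show ?thesis by (auto simp: FZ)
    qed
    ultimately show ?thesis by simp
  qed
  show ?thesis
    using F_events prod by (auto simp: indep_events_def)
qed

end

section \<open>Oscillation and counting estimates\<close>

text \<open>Paths are uniformly continuous on compact intervals, so the events that the path varies by more
than \<open>1\<close> over a distance \<open>1 / n\<close> decrease to a null set. Restricting the times to a countable dense set
makes these events measurable, and continuity recovers all times.\<close>

lemma (in finite_measure) small_oscillation_event:
  fixes Y :: "real \<Rightarrow> 'a \<Rightarrow> real"
  assumes meas: "\<And>s. s \<in> {u..v} \<Longrightarrow> Y s \<in> borel_measurable M"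
    and cont: "AE \<omega> in M. continuous_on {u..v} (\<lambda>s. Y s \<omega>)" and \<epsilon>: "0 < \<epsilon>"
  obtains N \<delta> where "N \<in> sets M" "measure M N \<le> \<epsilon>" "0 < \<delta>"
    "AE \<omega> in M. \<omega> \<notin> N \<longrightarrow>
      (\<forall>p\<in>{u..v}. \<forall>q\<in>{u..v}. \<bar>p - q\<bar> < \<delta> \<longrightarrow> \<bar>Y p \<omega> - Y q \<omega>\<bar> \<le> 1)"
proof -
  obtain T where T: "countable T" "T \<subseteq> {u..v}" "{u..v} \<subseteq> closure T"
    using separable[of "{u..v}"] by metis
  define N where "N n = {\<omega> \<in> space M. \<exists>p\<in>T. \<exists>q\<in>T. \<bar>p - q\<bar> < 1 / real (Suc n) \<and> 1 < \<bar>Y p \<omega> - Y q \<omega>\<bar>}"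
    for n
  have N_sets: "N n \<in> sets M" for n
  proof -
    have "N n = (\<Union>p\<in>T. \<Union>q\<in>{q\<in>T. \<bar>p - q\<bar> < 1 / real (Suc n)}. {\<omega> \<in> space M. 1 < \<bar>Y p \<omega> - Y q \<omega>\<bar>})"
      by (auto simp: N_def)
    also have "\<dots> \<in> sets M"
    proof (intro sets.countable_UN'' T(1))
      show "countable {q\<in>T. \<bar>p - q\<bar> < 1 / real (Suc n)}" for p
        using T(1) by (rule countable_subset[rotated]) auto
      fix p q assume "p \<in> T" "q \<in> {q\<in>T. \<bar>p - q\<bar> < 1 / real (Suc n)}"
      then have [measurable]: "Y p \<in> borel_measurable M" "Y q \<in> borel_measurable M"
        using T(2) by (auto intro!: meas)
      show "{\<omega> \<in> space M. 1 < \<bar>Y p \<omega> - Y q \<omega>\<bar>} \<in> sets M" by measurable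
    qed
    finally show ?thesis .
  qed
  have "decseq N"
  proof (rule antimonoI)
    fix m n :: nat assume "m \<le> n"
    then have "1 / real (Suc n) \<le> 1 / real (Suc m)" by (simp add: frac_le)
    then have "\<bar>p - q\<bar> < 1 / real (Suc m)" if "\<bar>p - q\<bar> < 1 / real (Suc n)" for p q :: real
      using that by linarith
    then show "N n \<subseteq> N m" unfolding N_def by blast
  qed
  then have "(\<lambda>n. measure M (N n)) \<longlonglongrightarrow> measure M (\<Inter>n. N n)"
    using N_sets by (intro finite_Lim_measure_decseq) auto
  moreover have "measure M (\<Inter>n. N n) = 0"
  proof -
    have "AE \<omega> in M. \<omega> \<notin> (\<Inter>n. N n)"
      using cont
    proof eventually_elim
      case (elim \<omega>)
      then have "uniformly_continuous_on {u..v} (\<lambda>s. Y s \<omega>)"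
        by (rule compact_uniformly_continuous) simp
      then obtain d where d: "0 < d" "\<And>p q. p \<in> {u..v} \<Longrightarrow> q \<in> {u..v} \<Longrightarrow> dist q p < d \<Longrightarrow>
          dist (Y q \<omega>) (Y p \<omega>) < 1"
        unfolding uniformly_continuous_on_def by (metis zero_less_one)
      obtain n where n: "1 / real (Suc n) < d"
        using d(1) reals_Archimedean[of d] by (auto simp: inverse_eq_divide)
      have "\<omega> \<notin> N n"
      proof
        assume "\<omega> \<in> N n"
        then obtain p q where "p \<in> T" "q \<in> T" "\<bar>p - q\<bar> < 1 / real (Suc n)" "1 < \<bar>Y p \<omega> - Y q \<omega>\<bar>"
          by (auto simp: N_def)
        moreover from this have "p \<in> {u..v}" "q \<in> {u..v}" using T(2) by blast+
        ultimately have "dist (Y p \<omega>) (Y q \<omega>) < 1"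
          using n by (intro d(2)) (simp_all only: dist_real_def)
        with \<open>1 < \<bar>Y p \<omega> - Y q \<omega>\<bar>\<close> show False by (simp add: dist_real_def)
      qed
      then show ?case by blast
    qed
    then show ?thesis
      using N_sets by (intro measure_eq_0_null_sets) (simp add: AE_iff_null_sets)
  qed
  ultimately have "(\<lambda>n. measure M (N n)) \<longlonglongrightarrow> 0" by simp
  then have "\<forall>\<^sub>F n in sequentially. measure M (N n) < \<epsilon>"
    using \<epsilon> by (rule order_tendstoD)
  then obtain n where n: "measure M (N n) < \<epsilon>" by (auto simp: eventually_sequentially)
  show ?thesis
  proof (rule that[of "N n" "1 / real (Suc n)"])
    show "AE \<omega> in M. \<omega> \<notin> N n \<longrightarrow>
      (\<forall>p\<in>{u..v}. \<forall>q\<in>{u..v}. \<bar>p - q\<bar> < 1 / real (Suc n) \<longrightarrow> \<bar>Y p \<omega> - Y q \<omega>\<bar> \<le> 1)"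
      using cont AE_space
    proof eventually_elim
      case (elim \<omega>)
      show ?case
      proof (intro impI ballI)
        fix p q assume \<omega>: "\<omega> \<notin> N n" and p: "p \<in> {u..v}" and q: "q \<in> {u..v}"
          and pq: "\<bar>p - q\<bar> < 1 / real (Suc n)"
        have "p \<in> closure T" "q \<in> closure T" using p q T(3) by blast+
        then obtain ps qs where ps: "\<And>k. ps k \<in> T" "ps \<longlonglongrightarrow> p"
          and qs: "\<And>k. qs k \<in> T" "qs \<longlonglongrightarrow> q"
          by (auto simp: closure_sequential)
        have Y_lim: "(\<lambda>k. Y (rs k) \<omega>) \<longlonglongrightarrow> Y r \<omega>" if "\<And>k. rs k \<in> T" "rs \<longlonglongrightarrow> r" "r \<in> {u..v}" for rs r
        proof (rule continuous_on_tendsto_compose[OF elim(1) that(2,3)])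
          show "\<forall>\<^sub>F k in sequentially. rs k \<in> {u..v}"
            using that(1) T(2) by (intro always_eventually allI) blast
        qed
        have "(\<lambda>k. \<bar>ps k - qs k\<bar>) \<longlonglongrightarrow> \<bar>p - q\<bar>"
          by (intro tendsto_intros ps qs)
        then have "\<forall>\<^sub>F k in sequentially. \<bar>ps k - qs k\<bar> < 1 / real (Suc n)"
          using pq by (rule order_tendstoD)
        then have "\<forall>\<^sub>F k in sequentially. \<bar>Y (ps k) \<omega> - Y (qs k) \<omega>\<bar> \<le> 1"
        proof eventually_elim
          case (elim k)
          then show ?case
            using \<omega> ps(1)[of k] qs(1)[of k] \<open>\<omega> \<in> space M\<close> by (force simp: N_def not_less)
        qed
        moreover have "(\<lambda>k. \<bar>Y (ps k) \<omega> - Y (qs k) \<omega>\<bar>) \<longlonglongrightarrow> \<bar>Y p \<omega> - Y q \<omega>\<bar>"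
          by (intro tendsto_intros Y_lim ps qs p q)
        ultimately show "\<bar>Y p \<omega> - Y q \<omega>\<bar> \<le> 1"
          by (intro tendsto_upperbound[of "\<lambda>k. \<bar>Y (ps k) \<omega> - Y (qs k) \<omega>\<bar>"]) auto
      qed
    qed
  qed (use N_sets n in auto)
qed

lemma (in finite_measure) tail_event_small:
  fixes Y :: "'a \<Rightarrow> real"
  assumes [measurable]: "Y \<in> borel_measurable M" and "0 < \<epsilon>"
  obtains K where "0 \<le> K" "measure M {\<omega> \<in> space M. K < \<bar>Y \<omega>\<bar>} \<le> \<epsilon>"
proof -
  define N where "N n = {\<omega> \<in> space M. real n < \<bar>Y \<omega>\<bar>}" for n
  have [measurable]: "N n \<in> sets M" for n unfolding N_def by measurable
  have "decseq N" by (rule antimonoI) (auto simp: N_def)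
  then have "(\<lambda>n. measure M (N n)) \<longlonglongrightarrow> measure M (\<Inter>n. N n)"
    by (intro finite_Lim_measure_decseq) auto
  moreover have "(\<Inter>n. N n) = {}"
    by (auto simp: N_def) (meson less_asym reals_Archimedean2)
  ultimately have "(\<lambda>n. measure M (N n)) \<longlonglongrightarrow> 0" by simp
  then have "\<forall>\<^sub>F n in sequentially. measure M (N n) < \<epsilon>"
    using assms(2) by (rule order_tendstoD)
  then obtain n where "measure M (N n) < \<epsilon>" by (auto simp: eventually_sequentially)
  then show ?thesis using that[of "real n"] by (simp add: N_def)
qed

lemma (in finite_measure) chebyshev_event:
  fixes Y :: "'a \<Rightarrow> real"
  assumes [measurable]: "Y \<in> borel_measurable M"
    and "(\<integral>\<^sup>+\<omega>. ennreal ((Y \<omega>)\<^sup>2) \<partial>M) \<le> ennreal \<epsilon>" "0 \<le> \<epsilon>"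
  shows "measure M {\<omega> \<in> space M. 1 < \<bar>Y \<omega>\<bar>} \<le> \<epsilon>"
proof -
  have "emeasure M {\<omega> \<in> space M. 1 < \<bar>Y \<omega>\<bar>} = (\<integral>\<^sup>+\<omega>. indicator {\<omega> \<in> space M. 1 < \<bar>Y \<omega>\<bar>} \<omega> \<partial>M)"
    by simp
  also have "\<dots> \<le> (\<integral>\<^sup>+\<omega>. ennreal ((Y \<omega>)\<^sup>2) \<partial>M)"
  proof (rule nn_integral_mono)
    fix \<omega>
    have "1 \<le> (Y \<omega>)\<^sup>2" if "1 < \<bar>Y \<omega>\<bar>"
      using that abs_le_square_iff[of 1 "Y \<omega>"] by simp
    then show "indicator {\<omega> \<in> space M. 1 < \<bar>Y \<omega>\<bar>} \<omega> \<le> ennreal ((Y \<omega>)\<^sup>2)"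
      by (auto simp: indicator_def)
  qed
  also have "\<dots> \<le> ennreal \<epsilon>" by fact
  finally show ?thesis using assms(3) by (simp add: emeasure_eq_measure)
qed

text \<open>The expectation of the weighted count is at least \<open>\<kappa>\<close> times the total weight, and the count never
exceeds the total weight, so it cannot be below half of that expectation too often.\<close>

lemma (in prob_space) weighted_count_lower_bound:
  fixes w :: "'i \<Rightarrow> real"
  assumes "finite J" and "0 \<le> \<kappa>" and w: "\<And>i. i \<in> J \<Longrightarrow> 0 \<le> w i" and E: "\<And>i. i \<in> J \<Longrightarrow> E i \<in> events"
    and \<kappa>: "\<And>i. i \<in> J \<Longrightarrow> \<kappa> \<le> prob (E i)" and pos: "0 < sum w J"
  shows "\<kappa> / 2 \<le> prob {\<omega> \<in> space M. \<kappa> / 2 * sum w J \<le> (\<Sum>i\<in>J. w i * indicator (E i) \<omega>)}"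
    (is "_ \<le> prob ?F")
proof -
  let ?R = "\<lambda>\<omega>. \<Sum>i\<in>J. w i * indicator (E i) \<omega> :: real"
  have R_meas [measurable]: "?R \<in> borel_measurable M"
    using E by (intro borel_measurable_sum borel_measurable_times borel_measurable_indicator) auto
  have int: "integrable M (\<lambda>\<omega>. w i * indicator (E i) \<omega> :: real)" if "i \<in> J" for i
    using E[OF that] by (intro integrable_mult_right integrable_real_indicator) (auto simp: emeasure_eq_measure)
  have F: "?F \<in> events" by measurable
  have "\<kappa> * sum w J \<le> (\<Sum>i\<in>J. w i * prob (E i))"
    unfolding sum_distrib_left using w \<kappa>
    by (intro sum_mono) (metis mult.commute mult_left_mono)
  also have "\<dots> = (\<Sum>i\<in>J. expectation (\<lambda>\<omega>. w i * indicator (E i) \<omega>))"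
    using E sets.sets_into_space by (intro sum.cong) (auto simp: Int_absorb2)
  also have "\<dots> = expectation ?R"
    using int by (intro Bochner_Integration.integral_sum[symmetric]) auto
  also have "\<dots> \<le> expectation (\<lambda>\<omega>. \<kappa> / 2 * sum w J + sum w J * indicator ?F \<omega>)"
  proof (rule integral_mono)
    show "integrable M ?R" using int by (intro Bochner_Integration.integrable_sum) auto
    show "integrable M (\<lambda>\<omega>. \<kappa> / 2 * sum w J + sum w J * indicator ?F \<omega>)"
      using F by (intro Bochner_Integration.integrable_add integrable_mult_right integrable_real_indicator)
        (auto simp: emeasure_eq_measure)
    fix \<omega> assume \<omega>: "\<omega> \<in> space M"
    have "?R \<omega> \<le> sum w J"
      using w by (intro sum_mono) (auto simp: indicator_def)
    moreover have "0 \<le> \<kappa> / 2 * sum w J"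
      using assms(2) pos by simp
    ultimately show "?R \<omega> \<le> \<kappa> / 2 * sum w J + sum w J * indicator ?F \<omega>"
      using \<omega> by (cases "\<omega> \<in> ?F") (simp_all add: add_increasing)
  qed
  also have "\<dots> = \<kappa> / 2 * sum w J + sum w J * prob ?F"
    using F by (subst Bochner_Integration.integral_add)
      (auto simp: emeasure_eq_measure prob_space)
  finally have "sum w J * (\<kappa> / 2) \<le> sum w J * prob ?F" by (simp add: algebra_simps)
  then show ?thesis using pos by simp
qed

section \<open>Unbounded weighted time above a level\<close>

text \<open>The setting of the almost sure argument: a Wiener integral whose variance grows without bound and a
function \<open>A\<close> that plays the antiderivative of a non-negative weight of infinite total mass. Times start at \<open>1\<close> since \<open>A\<close> need not have a limit at
\<open>0\<close>.\<close>

locale wiener_clock = brownian_motion +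
  fixes f A :: "real \<Rightarrow> real" and I :: "real \<Rightarrow> 'a \<Rightarrow> real"
  assumes f_measurable: "f \<in> borel_measurable lebesgue"
    and variance_unbounded: "\<And>t B. 0 \<le> t \<Longrightarrow>
      \<exists>u>t. ennreal B \<le> (\<integral>\<^sup>+s\<in>{t<..u}. ennreal ((f s)\<^sup>2) \<partial>lebesgue)"
    and I_wiener: "\<And>t. 0 \<le> t \<Longrightarrow> wiener_integral P W f t (I t)"
    and I_continuous: "AE \<omega> in P. continuous_on {0..} (\<lambda>t. I t \<omega>)"
    and A_mono: "mono_on {1..} A"
    and A_unbounded: "\<And>t. 1 \<le> t \<Longrightarrow> \<exists>u>t. 1 \<le> A u - A t"
begin

lemma I_measurable: "0 \<le> t \<Longrightarrow> I t \<in> borel_measurable P"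
  using I_wiener[of t] by (simp add: wiener_integral_def)

text \<open>A step integral is a function of finitely many values of \<open>W\<close>. Applying \<^const>\<open>step_integral\<close> to the
coordinate process exhibits this function, and as only differences of \<open>W\<close> occur it is the same for
\<open>W - W\<^sub>s\<close>.\<close>

lemma step_sum_event_is_increment_event:
  fixes w :: "'i \<Rightarrow> real"
  assumes ps: "\<And>i. i \<in> J \<Longrightarrow> \<forall>(c, u, v)\<in>set (ps i). s \<le> u \<and> u \<le> v \<and> v \<le> t" and J: "finite J"
  shows "increment_event s t {\<omega> \<in> space P.
    x \<le> (\<Sum>i\<in>J. w i * indicator {\<omega> \<in> space P. C \<le> step_integral W (ps i) \<omega>} \<omega>)}"
proof -
  define S where "S = (\<Union>i\<in>J. step_endpoints (ps i))"
  define Z where "Z = {z \<in> space (PiM S (\<lambda>_. borel)).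
    x \<le> (\<Sum>i\<in>J. w i * (if C \<le> step_integral (\<lambda>u z. z u) (ps i) z then 1 else 0))}"
  have S: "finite S" "S \<subseteq> {s..t}"
    using J ps by (auto simp: S_def step_endpoints_def) fastforce+
  have meas: "(\<lambda>z. step_integral (\<lambda>u z. z u) qs z) \<in> borel_measurable (PiM S (\<lambda>_. borel))"
    if "step_endpoints qs \<subseteq> S" for qs
    using that
  proof (induction qs)
    case (Cons q qs)
    obtain c u v where q: "q = (c, u, v)" by (cases q)
    have uv: "u \<in> S" "v \<in> S" using Cons.prems by (auto simp: q step_endpoints_def)
    have [measurable]: "(\<lambda>z. z u) \<in> borel_measurable (PiM S (\<lambda>_. borel :: real measure))"
        "(\<lambda>z. z v) \<in> borel_measurable (PiM S (\<lambda>_. borel :: real measure))"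
      using measurable_component_singleton[OF uv(1), of "\<lambda>_. borel"]
        measurable_component_singleton[OF uv(2), of "\<lambda>_. borel"] by auto
    have [measurable]: "(\<lambda>z. step_integral (\<lambda>u z. z u) qs z) \<in> borel_measurable (PiM S (\<lambda>_. borel))"
      using Cons by (auto simp: step_endpoints_def)
    have "step_integral (\<lambda>u z. z u) (q # qs) =
        (\<lambda>z. c * (z v - z u) + step_integral (\<lambda>u z. z u) qs z)"
      by (auto simp: step_integral_def q)
    then show ?case by simp
  qed (simp add: step_integral_def[abs_def])
  have [measurable]: "(\<lambda>z. \<Sum>i\<in>J. w i * (if C \<le> step_integral (\<lambda>u z. z u) (ps i) z then 1 else 0))
      \<in> borel_measurable (PiM S (\<lambda>_. borel))"
  proof (intro borel_measurable_sum borel_measurable_times borel_measurable_const)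
    fix i assume "i \<in> J"
    then have [measurable]: "(\<lambda>z. step_integral (\<lambda>u z. z u) (ps i) z) \<in> borel_measurable (PiM S (\<lambda>_. borel))"
      by (intro meas) (auto simp: S_def)
    show "(\<lambda>z. if C \<le> step_integral (\<lambda>u z. z u) (ps i) z then 1 else 0) \<in> borel_measurable (PiM S (\<lambda>_. borel))"
      by measurable
  qed
  have "Z \<in> sets (PiM S (\<lambda>_. borel))" unfolding Z_def by measurable
  moreover have "step_integral (\<lambda>u z. z u) (ps i) (restrict (\<lambda>u. W u \<omega> - W s \<omega>) S) =
      step_integral W (ps i) \<omega>" if "i \<in> J" for i \<omega>
  proof -
    have "step_endpoints qs \<subseteq> S \<Longrightarrow> step_integral (\<lambda>u z. z u) qs (restrict (\<lambda>u. W u \<omega> - W s \<omega>) S) =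
      step_integral W qs \<omega>" for qs
      by (induction qs) (auto simp: step_integral_def step_endpoints_def)
    then show ?thesis using that by (auto simp: S_def)
  qed
  then have "{\<omega> \<in> space P. x \<le> (\<Sum>i\<in>J. w i * indicator {\<omega> \<in> space P. C \<le> step_integral W (ps i) \<omega>} \<omega>)} =
      {\<omega> \<in> space P. restrict (\<lambda>u. W u \<omega> - W s \<omega>) S \<in> Z}"
    by (auto simp: Z_def space_PiM indicator_def of_bool_def cong: sum.cong)
  ultimately show ?thesis
    unfolding increment_event_def using S by blast
qed

text \<open>On the good event \<open>F\<close> and off the exceptional event \<open>N\<close>, every clock that counts the time above \<open>c\<close>
advances by a fixed amount over \<open>[t, t']\<close>. Only \<open>F\<close> needs to be an event of increments inside the
block; \<open>N\<close> may depend on the past, since its probability is small.\<close>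

definition sojourn_block :: "real \<Rightarrow> real \<Rightarrow> real \<Rightarrow> real \<Rightarrow> 'a set \<Rightarrow> 'a set \<Rightarrow> bool" where
  "sojourn_block c t \<epsilon> t' F N \<longleftrightarrow> t < t' \<and> increment_event t t' F \<and>
    std_normal_density 2 / 2 \<le> prob F \<and> N \<in> events \<and> prob N \<le> \<epsilon> \<and>
    (AE \<omega> in P. \<omega> \<in> F - N \<longrightarrow>
      (\<forall>H. clock_above A (\<lambda>s. I s \<omega>) c H \<longrightarrow> std_normal_density 2 / 2 \<le> H t' - H t))"

text \<open>The value \<open>I\<^sub>t\<close> from which the block starts is at most \<open>K\<close> in modulus, up to probability \<open>\<epsilon> / 3\<close>. Wait until
a time \<open>u\<close> at which the increment since \<open>t\<close> has a variance large compared with \<open>K\<close> and \<open>c\<close>; from then on it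
exceeds \<open>C = \<bar>c\<bar> + K + 2\<close> with probability at least \<open>\<kappa>\<close> at each single time. The part \<open>[u, t']\<close> has
\<open>a\<close>-weight at least \<open>1\<close>. Cut it into cells on which the path varies by at most \<open>1\<close>, and let \<open>F\<close> be the event
that the increment, approximated by step integrals, exceeds \<open>C\<close> at the left end points of cells of at least the
fraction \<open>\<kappa> / 2\<close> of the weight. On each such cell \<open>I\<close> stays above \<open>c\<close>: of the surplus \<open>2\<close> in \<open>C\<close>, one unit pays
for the approximation and one for the oscillation.\<close>

lemma sojourn_block_exists:
  assumes t: "1 \<le> t" and \<epsilon>: "0 < \<epsilon>"
  shows "\<exists>t' F N. sojourn_block c t \<epsilon> t' F N"
proof -
  let ?\<kappa> = "std_normal_density 2"
  have t0: "0 \<le> t" using t by simp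
  have \<epsilon>3: "0 < \<epsilon> / 3" using \<epsilon> by simp
  obtain K where K: "0 \<le> K" "prob {\<omega> \<in> space P. K < \<bar>I t \<omega>\<bar>} \<le> \<epsilon> / 3"
    using tail_event_small[OF I_measurable[OF t0] \<epsilon>3] by metis
  define C where "C = \<bar>c\<bar> + K + 2"
  have C: "0 < C" using K by (simp add: C_def)
  \<comment> \<open>An approximation at squared distance at most \<open>1\<close> retains half of this variance minus \<open>1\<close>, which is \<open>C\<^sup>2\<close>.\<close>
  obtain u where u: "t < u" "ennreal (2 * C\<^sup>2 + 2) \<le> (\<integral>\<^sup>+s\<in>{t<..u}. ennreal ((f s)\<^sup>2) \<partial>lebesgue)"
    using variance_unbounded[OF t0] by blast
  have u1: "1 \<le> u" using t u by simp
  obtain t' where t': "u < t'" "1 \<le> A t' - A u" using A_unbounded[OF u1] by blast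
  have "AE \<omega> in P. continuous_on {u..t'} (\<lambda>s. I s \<omega>)"
    using I_continuous by eventually_elim (rule continuous_on_subset, use u1 in auto)
  then obtain Osc \<delta> where Osc: "Osc \<in> events" "prob Osc \<le> \<epsilon> / 3" and \<delta>: "0 < \<delta>"
    and osc: "AE \<omega> in P. \<omega> \<notin> Osc \<longrightarrow>
      (\<forall>p\<in>{u..t'}. \<forall>q\<in>{u..t'}. \<bar>p - q\<bar> < \<delta> \<longrightarrow> \<bar>I p \<omega> - I q \<omega>\<bar> \<le> 1)"
    by (rule small_oscillation_event[of u t' I "\<epsilon> / 3", rotated])
      (use I_measurable u1 \<epsilon>3 in auto)
  obtain m where m: "(t' - u) / real (Suc m) < \<delta>"
  proof -
    obtain m where "(t' - u) / \<delta> < real m" using reals_Archimedean2 by blast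
    then have "(t' - u) / real (Suc m) < \<delta>" using \<delta> by (simp add: field_simps)
    then show ?thesis by (rule that)
  qed
  define n where "n = Suc m"
  define h where "h = (t' - u) / real n"
  define s where "s i = u + real i * h" for i
  have h: "0 < h" "h < \<delta>" using t' m by (auto simp: h_def n_def)
  have s0: "s 0 = u" and sn: "s n = t'" by (auto simp: s_def h_def n_def)
  have s_step: "s (Suc i) = s i + h" for i by (simp add: s_def algebra_simps)
  have s_mono: "s i \<le> s j" if "i \<le> j" for i j
    using that h by (simp add: s_def mult_right_mono)
  have s_range: "u \<le> s i" "s i \<le> t'" if "i \<le> n" for i
    using s_mono[of 0 i] s_mono[of i n] that s0 sn by auto
  \<comment> \<open>The errors at the \<open>n\<close> grid points together use up the last third of \<open>\<epsilon>\<close>.\<close>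
  define \<delta>' where "\<delta>' = min 1 (\<epsilon> / (3 * real n))"
  have \<delta>': "0 < \<delta>'" "\<delta>' \<le> 1"
    using \<epsilon> by (auto simp: \<delta>'_def n_def)
  have "real n * \<delta>' \<le> real n * (\<epsilon> / (3 * real n))"
    unfolding \<delta>'_def by (intro mult_left_mono) auto
  also have "\<dots> = \<epsilon> / 3"
  proof -
    have "real n \<noteq> 0" by (simp add: n_def)
    then show ?thesis by (simp add: field_simps)
  qed
  finally have n\<delta>': "real n * \<delta>' \<le> \<epsilon> / 3" .
  have "\<exists>ps. (\<forall>(c, u, v)\<in>set ps. t \<le> u \<and> u \<le> v \<and> v \<le> s i) \<and>
      ennreal (C\<^sup>2) \<le> (\<integral>\<^sup>+x. ennreal ((step_fun ps x)\<^sup>2) \<partial>lebesgue) \<and>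
      (\<integral>\<^sup>+\<omega>. ennreal ((I (s i) \<omega> - I t \<omega> - step_integral W ps \<omega>)\<^sup>2) \<partial>P) \<le> ennreal \<delta>'"
    if i: "i < n" for i
  proof -
    have si: "u \<le> s i" using s_range[of i] i by simp
    have tsi: "t \<le> s i" using si u by simp
    obtain ps where ps: "\<forall>(c, u, v)\<in>set ps. t \<le> u \<and> u \<le> v \<and> v \<le> s i"
      "(\<integral>\<^sup>+x\<in>{t<..s i}. ennreal ((f x)\<^sup>2) \<partial>lebesgue) \<le>
        2 * (ennreal \<delta>' + (\<integral>\<^sup>+x. ennreal ((step_fun ps x)\<^sup>2) \<partial>lebesgue))"
      "(\<integral>\<^sup>+\<omega>. ennreal ((I (s i) \<omega> - I t \<omega> - step_integral W ps \<omega>)\<^sup>2) \<partial>P) \<le> ennreal \<delta>'"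
      by (rule wiener_increment_approx[OF f_measurable I_wiener[OF t0] I_wiener t0 tsi \<delta>'(1)])
        (use tsi t0 in auto)
    have "2 * (1 + ennreal (C\<^sup>2)) = ennreal (2 * C\<^sup>2 + 2)"
      by (simp add: ennreal_plus ennreal_mult distrib_left add.commute)
    also have "\<dots> \<le> (\<integral>\<^sup>+x\<in>{t<..s i}. ennreal ((f x)\<^sup>2) \<partial>lebesgue)"
      using u(2) by (rule order.trans) (intro nn_integral_mono, use si in \<open>auto simp: indicator_def\<close>)
    also have "\<dots> \<le> 2 * (1 + (\<integral>\<^sup>+x. ennreal ((step_fun ps x)\<^sup>2) \<partial>lebesgue))"
      using ps(2) by (rule order.trans) (intro mult_left_mono add_mono, use \<delta>' in auto)
    finally have "ennreal (C\<^sup>2) \<le> (\<integral>\<^sup>+x. ennreal ((step_fun ps x)\<^sup>2) \<partial>lebesgue)"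
      by (simp add: ennreal_mult_le_mult_iff)
    then show ?thesis using ps(1,3) by blast
  qed
  then have "\<forall>i. \<exists>ps. i < n \<longrightarrow> ((\<forall>(c, u, v)\<in>set ps. t \<le> u \<and> u \<le> v \<and> v \<le> s i) \<and>
      ennreal (C\<^sup>2) \<le> (\<integral>\<^sup>+x. ennreal ((step_fun ps x)\<^sup>2) \<partial>lebesgue) \<and>
      (\<integral>\<^sup>+\<omega>. ennreal ((I (s i) \<omega> - I t \<omega> - step_integral W ps \<omega>)\<^sup>2) \<partial>P) \<le> ennreal \<delta>')"
    by blast
  from choice[OF this] obtain ps where
    ps: "\<And>i. i < n \<Longrightarrow> \<forall>(c, u, v)\<in>set (ps i). t \<le> u \<and> u \<le> v \<and> v \<le> s i"
    and var: "\<And>i. i < n \<Longrightarrow> ennreal (C\<^sup>2) \<le> (\<integral>\<^sup>+x. ennreal ((step_fun (ps i) x)\<^sup>2) \<partial>lebesgue)"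
    and err: "\<And>i. i < n \<Longrightarrow>
      (\<integral>\<^sup>+\<omega>. ennreal ((I (s i) \<omega> - I t \<omega> - step_integral W (ps i) \<omega>)\<^sup>2) \<partial>P) \<le> ennreal \<delta>'"
    by blast
  have ps_list: "step_list (s i) (ps i)" if "i < n" for i
    using ps[OF that] t0 unfolding step_list_def by fastforce
  note S_meas = step_integral_measurable[OF ps_list]
  define E where "E i = {\<omega> \<in> space P. C \<le> step_integral W (ps i) \<omega>}" for i
  define w where "w i = A (s (Suc i)) - A (s i)" for i
  define F where "F = {\<omega> \<in> space P. ?\<kappa> / 2 * sum w {..<n} \<le> (\<Sum>i<n. w i * indicator (E i) \<omega>)}"
  define R where "R i = {\<omega> \<in> space P. 1 < \<bar>I (s i) \<omega> - I t \<omega> - step_integral W (ps i) \<omega>\<bar>}" for i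
  define N where "N = {\<omega> \<in> space P. K < \<bar>I t \<omega>\<bar>} \<union> Osc \<union> (\<Union>i<n. R i)"
  have w0: "0 \<le> w i" if "i < n" for i
    using A_mono s_mono[of i "Suc i"] s_range[of i] u1 that by (auto simp: w_def mono_on_def)
  have sum_w: "sum w {..<n} = A t' - A u"
    unfolding w_def using sum_lessThan_telescope[of "\<lambda>i. A (s i)" n] by (simp add: s0 sn)
  have E_events: "E i \<in> events" if "i < n" for i
    using S_meas[OF that] unfolding E_def by measurable
  have F_prob: "?\<kappa> / 2 \<le> prob F"
    unfolding F_def
  proof (rule weighted_count_lower_bound)
    fix i assume "i \<in> {..<n}"
    then show "?\<kappa> \<le> prob (E i)"
      unfolding E_def by (intro step_integral_upper_tail[OF ps_list C var]) auto
  qed (use w0 E_events sum_w t' in auto)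
  have "increment_event t t' F"
    unfolding F_def E_def
  proof (rule step_sum_event_is_increment_event)
    fix i assume "i \<in> {..<n}"
    then show "\<forall>(c, u, v)\<in>set (ps i). t \<le> u \<and> u \<le> v \<and> v \<le> t'"
      using ps[of i] s_range[of i] by fastforce
  qed simp
  have diff_meas: "(\<lambda>\<omega>. I (s i) \<omega> - I t \<omega> - step_integral W (ps i) \<omega>) \<in> borel_measurable P"
    if "i < n" for i
    using S_meas[OF that] I_measurable[of "s i"] I_measurable[OF t0] s_range[of i] that u1
    by (intro borel_measurable_diff) auto
  have R_events: "R i \<in> events" and R_prob: "prob (R i) \<le> \<delta>'" if "i < n" for i
    using diff_meas[OF that] chebyshev_event[OF diff_meas[OF that] err[OF that]] \<delta>'
    unfolding R_def by (measurable, auto)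
  have K_events: "{\<omega> \<in> space P. K < \<bar>I t \<omega>\<bar>} \<in> events"
    using I_measurable[OF t0] by measurable
  have UR: "(\<Union>i<n. R i) \<in> events" using R_events by auto
  have N_events: "N \<in> events" unfolding N_def using K_events Osc UR by auto
  have "prob (\<Union>i<n. R i) \<le> (\<Sum>i<n. prob (R i))"
    using R_events by (intro finite_measure_subadditive_finite) auto
  also have "\<dots> \<le> (\<Sum>i<n. \<delta>')" by (intro sum_mono R_prob) auto
  also have "\<dots> \<le> \<epsilon> / 3" using n\<delta>' by simp
  finally have UR_prob: "prob (\<Union>i<n. R i) \<le> \<epsilon> / 3" .
  have N_prob: "prob N \<le> \<epsilon>"
  proof -
    have "prob N \<le> prob ({\<omega> \<in> space P. K < \<bar>I t \<omega>\<bar>} \<union> Osc) + prob (\<Union>i<n. R i)"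
      unfolding N_def using K_events Osc UR by (intro measure_Un_le) auto
    also have "prob ({\<omega> \<in> space P. K < \<bar>I t \<omega>\<bar>} \<union> Osc) \<le> prob {\<omega> \<in> space P. K < \<bar>I t \<omega>\<bar>} + prob Osc"
      using K_events Osc by (intro measure_Un_le) auto
    finally show ?thesis using K(2) Osc(2) UR_prob by simp
  qed
  have "AE \<omega> in P. \<omega> \<in> F - N \<longrightarrow>
      (\<forall>H. clock_above A (\<lambda>s. I s \<omega>) c H \<longrightarrow> ?\<kappa> / 2 \<le> H t' - H t)"
    using osc
  proof (eventually_elim, intro impI allI)
    fix \<omega> H
    assume osc: "\<omega> \<notin> Osc \<longrightarrow>
      (\<forall>p\<in>{u..t'}. \<forall>q\<in>{u..t'}. \<bar>p - q\<bar> < \<delta> \<longrightarrow> \<bar>I p \<omega> - I q \<omega>\<bar> \<le> 1)"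
      and \<omega>: "\<omega> \<in> F - N" and H: "clock_above A (\<lambda>s. I s \<omega>) c H"
    have H_mono: "H p \<le> H q" if "1 \<le> p" "p \<le> q" for p q
      using H that by (auto simp: clock_above_def mono_on_def)
    have inc: "w i * indicator (E i) \<omega> \<le> H (s (Suc i)) - H (s i)" if i: "i < n" for i
    proof (cases "\<omega> \<in> E i")
      case True
      have "\<omega> \<in> space P" "\<omega> \<notin> R i" "\<bar>I t \<omega>\<bar> \<le> K" "\<omega> \<notin> Osc"
        using \<omega> i by (auto simp: N_def F_def not_less)
      then have "\<bar>c\<bar> + 1 \<le> I (s i) \<omega>"
        using True by (auto simp: E_def R_def C_def)
      moreover have "\<bar>I p \<omega> - I (s i) \<omega>\<bar> \<le> 1" if "p \<in> {s i..s (Suc i)}" for p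
        using osc \<open>\<omega> \<notin> Osc\<close> that s_range[of i] s_range[of "Suc i"] s_step[of i] h i by auto
      ultimately have "\<forall>p\<in>{s i..s (Suc i)}. c \<le> I p \<omega>" by fastforce
      then show ?thesis
        using H True s_range[of i] s_mono[of i "Suc i"] u1 i by (auto simp: clock_above_def w_def)
    next
      case False
      then show ?thesis
        using H_mono[of "s i" "s (Suc i)"] s_range[of i] s_mono[of i "Suc i"] u1 i by auto
    qed
    have "?\<kappa> / 2 \<le> ?\<kappa> / 2 * sum w {..<n}"
      using mult_left_mono[of 1 "sum w {..<n}" "?\<kappa> / 2"] t' sum_w by simp
    also have "\<dots> \<le> (\<Sum>i<n. w i * indicator (E i) \<omega>)" using \<omega> by (simp add: F_def)
    also have "\<dots> \<le> (\<Sum>i<n. H (s (Suc i)) - H (s i))" by (intro sum_mono inc) auto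
    also have "\<dots> = H t' - H u"
      using sum_lessThan_telescope[of "\<lambda>i. H (s i)" n] by (simp add: s0 sn)
    also have "\<dots> \<le> H t' - H t" using H_mono[of t u] t u by simp
    finally show "?\<kappa> / 2 \<le> H t' - H t" .
  qed
  then have "sojourn_block c t \<epsilon> t' F N"
    unfolding sojourn_block_def
    using \<open>increment_event t t' F\<close> F_prob N_events N_prob t' u by auto
  then show ?thesis by blast
qed

text \<open>Iterating the block construction with \<open>\<epsilon> = 2\<^sup>-\<^sup>k\<close> gives independent good events of probability at least
\<open>\<kappa> / 2\<close>. The probability that infinitely many of them occur is at least \<open>\<kappa> / 2\<close>, hence \<open>1\<close> by the
zero-one law. Only finitely many exceptional events occur, so a clock advances by \<open>\<kappa> / 2\<close> infinitely often.\<close>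

lemma clock_unbounded:
  "AE \<omega> in P. \<forall>H B. clock_above A (\<lambda>s. I s \<omega>) c H \<longrightarrow> \<not> (\<forall>t. H t \<le> B)"
proof -
  let ?\<kappa> = "std_normal_density 2"
  have "\<forall>t k. \<exists>z. 1 \<le> t \<longrightarrow> sojourn_block c t ((1/2) ^ k) (fst z) (fst (snd z)) (snd (snd z))"
    using sojourn_block_exists by fastforce
  then obtain z where z: "\<And>t k. 1 \<le> t \<Longrightarrow>
      sojourn_block c t ((1/2) ^ k) (fst (z t k)) (fst (snd (z t k))) (snd (snd (z t k)))"
    by metis
  define \<tau> where "\<tau> = rec_nat 1 (\<lambda>k t. fst (z t k))"
  define F where "F k = fst (snd (z (\<tau> k) k))" for k
  define N where "N k = snd (snd (z (\<tau> k) k))" for k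
  have \<tau>_simps: "\<tau> 0 = 1" "\<And>k. \<tau> (Suc k) = fst (z (\<tau> k) k)" by (simp_all add: \<tau>_def)
  have block: "1 \<le> \<tau> k \<and> sojourn_block c (\<tau> k) ((1/2) ^ k) (\<tau> (Suc k)) (F k) (N k)" for k
  proof (induction k)
    case 0
    then show ?case using z[of "\<tau> 0" 0] by (simp add: \<tau>_simps F_def N_def)
  next
    case (Suc k)
    then have "1 \<le> \<tau> (Suc k)" by (auto simp: sojourn_block_def)
    then show ?case using z[of "\<tau> (Suc k)" "Suc k"] by (simp add: \<tau>_simps(2)[of "Suc k"] F_def N_def)
  qed
  then have \<tau>_less: "\<And>k. \<tau> k < \<tau> (Suc k)" and F_inc: "\<And>k. increment_event (\<tau> k) (\<tau> (Suc k)) (F k)"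
    and F_prob: "\<And>k. ?\<kappa> / 2 \<le> prob (F k)" and N: "\<And>k. N k \<in> events" "\<And>k. prob (N k) \<le> (1/2) ^ k"
    and gain: "\<And>k. AE \<omega> in P. \<omega> \<in> F k - N k \<longrightarrow>
      (\<forall>H. clock_above A (\<lambda>s. I s \<omega>) c H \<longrightarrow> ?\<kappa> / 2 \<le> H (\<tau> (Suc k)) - H (\<tau> k))"
    by (auto simp: sojourn_block_def)
  have \<tau>_mono: "strict_mono \<tau>" using \<tau>_less by (simp add: strict_mono_Suc_iff)
  have \<kappa>: "0 < ?\<kappa>" by (simp add: std_normal_density_def)
  have indep: "indep_events F UNIV"
    by (rule increment_events_indep[OF _ \<tau>_mono F_inc]) (simp add: \<tau>_simps)
  then have F_events: "F k \<in> events" for k by (auto simp: indep_events_def)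
  have infinitely_often: "AE \<omega> in P. infinite {k. \<omega> \<in> F k}"
  proof -
    have F_eq: "F = (\<lambda>k. {\<omega> \<in> space P. \<omega> \<in> F k})"
      using F_events sets.sets_into_space by fastforce
    have "(AE \<omega> in P. infinite {k. \<omega> \<in> F k}) \<or> (AE \<omega> in P. finite {k. \<omega> \<in> F k})"
      by (rule borel_0_1_law_AE) (use indep F_eq in simp)
    moreover have "\<not> (AE \<omega> in P. finite {k. \<omega> \<in> F k})"
    proof
      assume fin: "AE \<omega> in P. finite {k. \<omega> \<in> F k}"
      \<comment> \<open>Otherwise the limit superior of the \<open>F k\<close> would be a null set, but it has probability at least \<open>\<kappa> / 2\<close>.\<close>
      define G where "G n = (\<Union>k\<in>{n..}. F k)" for n
      have G_events: "G n \<in> events" for n using F_events by (auto simp: G_def)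
      have "decseq G" unfolding G_def by (rule antimonoI, rule UN_mono) auto
      then have "(\<lambda>n. prob (G n)) \<longlonglongrightarrow> prob (\<Inter>n. G n)"
        using G_events by (intro finite_Lim_measure_decseq) auto
      moreover have "?\<kappa> / 2 \<le> prob (G n)" for n
      proof -
        have "prob (F n) \<le> prob (G n)"
          using G_events by (intro finite_measure_mono) (auto simp: G_def)
        then show ?thesis using F_prob[of n] by linarith
      qed
      ultimately have "?\<kappa> / 2 \<le> prob (\<Inter>n. G n)"
        by (intro LIMSEQ_le_const) auto
      moreover have "AE \<omega> in P. \<omega> \<notin> (\<Inter>n. G n)"
        using fin
      proof eventually_elim
        case (elim \<omega>)
        then obtain m where "{k. \<omega> \<in> F k} \<subseteq> {..m}"
          unfolding finite_nat_iff_bounded_le by blast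
        then have "\<omega> \<notin> G (Suc m)" by (auto simp: G_def)
        then show ?case by blast
      qed
      then have "prob (\<Inter>n. G n) = 0"
        using G_events by (intro measure_eq_0_null_sets) (auto simp: AE_iff_null_sets)
      ultimately show False using \<kappa> by simp
    qed
    ultimately show ?thesis by blast
  qed
  have "AE \<omega> in P. \<forall>\<^sub>F k in sequentially. \<omega> \<in> space P - N k"
  proof (rule borel_cantelli_AE1)
    show "summable (\<lambda>k. prob (N k))"
    proof (rule summable_comparison_test'[of "\<lambda>k. (1/2::real) ^ k" 0])
      show "summable (\<lambda>k. (1/2::real) ^ k)" by (rule summable_geometric) simp
      show "norm (prob (N k)) \<le> (1/2) ^ k" for k
        using N(2)[of k] by (simp only: real_norm_def abs_of_nonneg measure_nonneg)
    qed
  qed (use N in \<open>auto simp: emeasure_eq_measure\<close>)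
  moreover have "AE \<omega> in P. \<forall>k. \<omega> \<in> F k - N k \<longrightarrow>
      (\<forall>H. clock_above A (\<lambda>s. I s \<omega>) c H \<longrightarrow> ?\<kappa> / 2 \<le> H (\<tau> (Suc k)) - H (\<tau> k))"
    using gain by (simp add: AE_all_countable)
  ultimately show ?thesis
    using infinitely_often
  proof (eventually_elim, intro allI impI notI)
    fix \<omega> H B
    assume ev: "\<forall>\<^sub>F k in sequentially. \<omega> \<in> space P - N k"
      and gain: "\<forall>k. \<omega> \<in> F k - N k \<longrightarrow>
        (\<forall>H. clock_above A (\<lambda>s. I s \<omega>) c H \<longrightarrow> ?\<kappa> / 2 \<le> H (\<tau> (Suc k)) - H (\<tau> k))"
      and inf: "infinite {k. \<omega> \<in> F k}" and H: "clock_above A (\<lambda>s. I s \<omega>) c H" and B: "\<forall>t. H t \<le> B"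
    obtain k0 where k0: "\<And>k. k0 \<le> k \<Longrightarrow> \<omega> \<notin> N k" using ev by (auto simp: eventually_sequentially)
    define g where "g k = H (\<tau> (Suc k)) - H (\<tau> k)" for k
    have g0: "0 \<le> g k" for k
      using H block[of k] \<tau>_less[of k] by (auto simp: clock_above_def mono_on_def g_def)
    \<comment> \<open>The advances of a bounded clock are summable, so they tend to \<open>0\<close>.\<close>
    have summable: "summable g"
    proof (rule summableI_nonneg_bounded[where x = "B - H (\<tau> 0)"])
      show "(\<Sum>k<n. g k) \<le> B - H (\<tau> 0)" for n
        using B sum_lessThan_telescope[of "\<lambda>k. H (\<tau> k)" n] by (simp add: g_def)
    qed (rule g0)
    have "\<forall>\<^sub>F k in sequentially. g k < ?\<kappa> / 2"
      using summable_LIMSEQ_zero[OF summable] \<kappa> by (intro order_tendstoD) auto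
    then obtain k1 where k1: "\<And>k. k1 \<le> k \<Longrightarrow> g k < ?\<kappa> / 2" by (auto simp: eventually_sequentially)
    have "\<exists>k\<ge>max k0 k1. \<omega> \<in> F k"
      using inf by (simp only: infinite_nat_iff_unbounded_le mem_Collect_eq)
    then obtain k where "max k0 k1 \<le> k" "\<omega> \<in> F k" by blast
    then show False using gain H k0[of k] k1[of k] by (force simp: g_def)
  qed
qed

end

section \<open>The Osgood criterion\<close>

text \<open>The measure with density \<open>f\<^sup>2\<close> is finite on bounded intervals and infinite on \<open>[0, \<infinity>)\<close>, so it is infinite on
\<open>(t, \<infinity>)\<close>, and continuity from below applies.\<close>

lemma square_integral_tail_unbounded:
  fixes f :: "real \<Rightarrow> real"
  assumes f: "f \<in> borel_measurable lebesgue"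
    and fin: "\<And>K. K > 0 \<Longrightarrow> (\<integral>\<^sup>+s\<in>{0..K}. ennreal ((f s)\<^sup>2) \<partial>lebesgue) < \<infinity>"
    and inf: "(\<integral>\<^sup>+s\<in>{0..}. ennreal ((f s)\<^sup>2) \<partial>lebesgue) = \<infinity>" and t: "0 \<le> t"
  shows "\<exists>u>t. ennreal B \<le> (\<integral>\<^sup>+s\<in>{t<..u}. ennreal ((f s)\<^sup>2) \<partial>lebesgue)"
proof -
  define \<nu> where "\<nu> = density lebesgue (\<lambda>s. ennreal ((f s)\<^sup>2))"
  have meas: "(\<lambda>s. ennreal ((f s)\<^sup>2)) \<in> borel_measurable lebesgue"
    using f by measurable
  have \<nu>: "emeasure \<nu> S = (\<integral>\<^sup>+s\<in>S. ennreal ((f s)\<^sup>2) \<partial>lebesgue)" if "S \<in> sets borel" for S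
    unfolding \<nu>_def using that by (intro emeasure_density meas) auto
  have sets: "S \<in> sets \<nu>" if "S \<in> sets borel" for S
    using that by (simp add: \<nu>_def)
  have "emeasure \<nu> {0..} \<le> emeasure \<nu> {0..t + 1} + emeasure \<nu> {t<..}"
  proof -
    have "emeasure \<nu> {0..} \<le> emeasure \<nu> ({0..t + 1} \<union> {t<..})"
      by (intro emeasure_mono sets) auto
    also have "\<dots> \<le> emeasure \<nu> {0..t + 1} + emeasure \<nu> {t<..}"
      by (intro emeasure_subadditive sets) auto
    finally show ?thesis .
  qed
  then have "emeasure \<nu> {t<..} = \<infinity>"
    using inf fin[of "t + 1"] t by (auto simp: \<nu> top_unique less_top[symmetric] ennreal_add_eq_top)
  moreover have "(SUP n. emeasure \<nu> {t<..t + real n}) = emeasure \<nu> (\<Union>n. {t<..t + real n})"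
    by (intro SUP_emeasure_incseq) (auto simp: incseq_def intro!: sets)
  moreover have "(\<Union>n. {t<..t + real n}) = {t<..}"
  proof (intro equalityI subsetI)
    fix x assume "x \<in> {t<..}"
    moreover obtain n where "x - t \<le> real n" using real_arch_simple by blast
    ultimately show "x \<in> (\<Union>n. {t<..t + real n})" by (auto intro!: exI[of _ n])
  qed auto
  ultimately have "(SUP n. emeasure \<nu> {t<..t + real n}) = \<infinity>" by (simp only:)
  then have "ennreal B < (SUP n. emeasure \<nu> {t<..t + real n})" by (simp only: infinity_ennreal_def ennreal_less_top)
  then obtain n where n: "ennreal B < emeasure \<nu> {t<..t + real n}"
    by (auto simp: less_SUP_iff)
  also have "\<dots> \<le> emeasure \<nu> {t<..t + real n + 1}"
    by (intro emeasure_mono sets) auto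
  finally show ?thesis
    by (intro exI[of _ "t + real n + 1"]) (auto simp: \<nu>)
qed

text \<open>Every late window of length \<open>\<eta>\<close> has weight at least some fixed \<open>l > 0\<close>, so finitely many adjacent windows
have weight at least \<open>1\<close>.\<close>

lemma antiderivative_unbounded:
  fixes a A :: "real \<Rightarrow> real" and L :: ereal
  assumes a: "continuous_on {0<..} a" "\<And>t. t > 0 \<Longrightarrow> a t > 0"
    and A: "\<And>t. t > 0 \<Longrightarrow> (A has_real_derivative a t) (at t)"
    and \<eta>: "0 < \<eta>" and L: "0 < L"
    and lim: "((\<lambda>t. ereal (LINT s:{t..t+\<eta>}|lebesgue. a s)) \<longlongrightarrow> L) at_top"
  shows "mono_on {1..} A" "\<And>t. 1 \<le> t \<Longrightarrow> \<exists>u>t. 1 \<le> A u - A t"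
proof -
  have mono: "A s \<le> A t" if "1 \<le> s" "s \<le> t" for s t
  proof (rule DERIV_nonneg_imp_nondecreasing[OF that(2)])
    fix x assume "s \<le> x" "x \<le> t"
    then have "0 < x" using that by simp
    then show "\<exists>y. (A has_real_derivative y) (at x) \<and> 0 \<le> y"
      using A a(2) by (intro exI[of _ "a x"]) (auto intro: less_imp_le)
  qed
  then show "mono_on {1..} A" by (auto intro!: mono_onI)
  fix t :: real assume t: "1 \<le> t"
  obtain l where l: "0 < ereal l" "ereal l < L" using ereal_dense2[OF L] by blast
  have "\<forall>\<^sub>F s in at_top. ereal l < ereal (LINT x:{s..s+\<eta>}|lebesgue. a x)"
    using lim l(2) by (rule order_tendstoD)
  then obtain s0 where s0: "\<And>s. s0 \<le> s \<Longrightarrow> l < (LINT x:{s..s+\<eta>}|lebesgue. a x)"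
    by (auto simp: eventually_at_top_linorder)
  have window: "l \<le> A (s + \<eta>) - A s" if s: "s0 \<le> s" "1 \<le> s" for s
  proof -
    have "continuous_on {s..s+\<eta>} a" using a(1) by (rule continuous_on_subset) (use s in auto)
    then have "(LINT x:{s..s+\<eta>}|lebesgue. a x) = integral {s..s+\<eta>} a"
      by (intro set_lebesgue_integral_eq_integral absolutely_integrable_continuous_real)
    also have "\<dots> = A (s + \<eta>) - A s"
    proof (rule integral_unique, rule fundamental_theorem_of_calculus)
      show "(A has_vector_derivative a x) (at x within {s..s+\<eta>})" if "x \<in> {s..s+\<eta>}" for x
        using A[of x] that s unfolding has_real_derivative_iff_has_vector_derivative
        by (auto intro: has_vector_derivative_at_within)
    qed (use \<eta> in auto)
    finally show ?thesis using s0[OF s(1)] by simp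
  qed
  define s where "s = max t s0"
  have s: "t \<le> s" "s0 \<le> s" "1 \<le> s" using t by (auto simp: s_def)
  have growth: "real k * l \<le> A (s + real k * \<eta>) - A s" for k
  proof (induction k)
    case (Suc k)
    have "0 \<le> real k * \<eta>" using \<eta> by simp
    then have "l \<le> A (s + real k * \<eta> + \<eta>) - A (s + real k * \<eta>)"
      using s by (intro window) auto
    with Suc show ?case by (simp add: algebra_simps)
  qed simp
  obtain k where k: "1 / l < real k" using reals_Archimedean2 by blast
  then have "1 < real k * l" using l(1) by (simp add: field_simps)
  then have "1 \<le> A (s + real k * \<eta>) - A t"
    using growth[of k] mono[of t s] t s by simp
  moreover have "0 < real k" using k l(1) by (intro le_less_trans[OF _ k]) auto
  then have "0 < real k * \<eta>" using \<eta> by simp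
  then have "t < s + real k * \<eta>" using s by linarith
  ultimately show "\<exists>u>t. 1 \<le> A u - A t" by blast
qed

lemma wiener_integral_cong:
  assumes "\<And>s. 0 \<le> s \<Longrightarrow> f s = g s" "wiener_integral P W f t Y"
  shows "wiener_integral P W g t Y"
proof -
  have "(\<integral>\<^sup>+s\<in>{0..t}. ennreal ((f s - step_fun ps s)\<^sup>2) \<partial>lebesgue) =
      (\<integral>\<^sup>+s\<in>{0..t}. ennreal ((g s - step_fun ps s)\<^sup>2) \<partial>lebesgue)" for ps
    using assms(1) by (intro nn_integral_cong) (auto simp: indicator_def)
  with assms(2) show ?thesis by (simp add: wiener_integral_def)
qed

theorem theorem14:
  fixes P :: "'a measure"
    and W I :: "real \<Rightarrow> 'a \<Rightarrow> real"
    and X :: "real \<Rightarrow> 'a \<Rightarrow> ereal"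
    and a b f :: "real \<Rightarrow> real"
    and \<xi> r :: real
    and l :: ereal
  assumes "complete_measure P" and "brownian_motion P W"
    and "continuous_on {0<..} a" and "\<And>t. t > 0 \<Longrightarrow> a t > 0"
    and "\<exists>\<eta>>0. \<exists>L::ereal. L > 0 \<and>
      ((\<lambda>t. ereal (LINT s:{t..t+\<eta>}|lebesgue. a s)) \<longlongrightarrow> L) at_top"
    and "continuous_on UNIV b" and "\<And>x. b x \<ge> 0"
    and "l < \<infinity>" and "\<And>x. l < ereal x \<Longrightarrow> b x > 0"
    and "local_lipschitz (UNIV :: real set) {x. l < ereal x} (\<lambda>_. b)"
    and "\<And>x. x \<ge> r \<Longrightarrow> b x > 0" and "mono_on {r..} b"
    and "f \<in> borel_measurable (lebesgue_on {0..})"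
    and "\<And>K. K > 0 \<Longrightarrow> set_integrable lebesgue {0..K} (\<lambda>s. (f s)\<^sup>2)"
    and "(\<integral>\<^sup>+s\<in>{0..}. ennreal ((f s)\<^sup>2) \<partial>lebesgue) = \<infinity>"
    and "\<exists>M::nat. \<exists>p::real. M > 0 \<and> p > 0 \<and>
      summable (\<lambda>k. let n = real (M + k) in
        1 / Upsilon f n powr p * (LINT s:{n..n+2}|lebesgue. (f s)\<^sup>2) powr (p / 2))"
    and "continuous_wiener_process P W f I"
    and "solves_up_to_explosion P a b \<xi> I X"
  shows "blows_up_almost_surely P X \<longleftrightarrow> (\<integral>\<^sup>+x\<in>{r..}. ennreal (1 / b x) \<partial>lebesgue) < \<infinity>"
proof -
  interpret P: complete_measure P by fact
  interpret brownian_motion P W by fact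
  note a = assms(3,4) and b = assms(6,7,11,12)
  obtain G where G: "\<And>y. (G has_real_derivative 1 / b (max r y)) (at y)"
    using osgood_antiderivative_exists[OF b(1,3)] by blast
  obtain A where A: "\<And>t. t > 0 \<Longrightarrow> (A has_real_derivative a t) (at t)"
    using antiderivative_on_pos_exists[OF a(1)] by blast
  have I_cont: "AE \<omega> in P. continuous_on {0..} (\<lambda>t. I t \<omega>)"
    using assms(17) by (simp add: continuous_wiener_process_def)
  have sol: "AE \<omega> in P. solution_path a b \<xi> (\<lambda>t. I t \<omega>) (explosion_time X \<omega>) (\<lambda>t. X t \<omega>)"
    using assms(18) unfolding solves_up_to_explosion_def solution_path_def by blast
  have "blows_up_almost_surely P X \<longleftrightarrow> (\<exists>B. \<forall>y. G y \<le> B)"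
  proof (rule iffI)
    assume blow: "blows_up_almost_surely P X"
    show "\<exists>B. \<forall>y. G y \<le> B"
    proof (rule ccontr)
      assume unbounded: "\<not> (\<exists>B. \<forall>y. G y \<le> B)"
      have "AE \<omega> in P. \<not> explosion_time X \<omega> < \<infinity>"
        using sol I_cont
      proof eventually_elim
        case (elim \<omega>)
        have "0 \<le> explosion_time X \<omega>"
          by (auto simp: explosion_time_def intro!: INF_greatest)
        from osgood_divergent_imp_no_explosion[OF elim(1) this elim(2) a b G unbounded]
        show ?case by simp
      qed
      then have "{\<omega> \<in> space P. explosion_time X \<omega> < \<infinity>} \<in> null_sets P"
        unfolding P.AE_iff_null_sets by simp
      then have "measure P {\<omega> \<in> space P. explosion_time X \<omega> < \<infinity>} = 0"
        by (rule measure_eq_0_null_sets)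
      with blow show False by (simp add: blows_up_almost_surely_def)
    qed
  next
    assume "\<exists>B. \<forall>y. G y \<le> B"
    then obtain B where B: "\<And>y. G y \<le> B" by blast
    obtain \<eta> L where \<eta>L: "0 < \<eta>" "0 < L"
      "((\<lambda>t. ereal (LINT s:{t..t+\<eta>}|lebesgue. a s)) \<longlongrightarrow> L) at_top"
      using assms(5) by blast
    \<comment> \<open>Extending \<open>f\<close> by \<open>0\<close> makes it measurable on the whole line.\<close>
    define g where "g s = indicator {0..} s *\<^sub>R f s" for s
    have g: "g s = f s" if "0 \<le> s" for s using that by (simp add: g_def)
    have g_measurable: "g \<in> borel_measurable lebesgue"
      using assms(13) unfolding g_def by (subst (asm) borel_measurable_restrict_space_iff) auto
    have g_square: "(\<integral>\<^sup>+s\<in>S. ennreal ((g s)\<^sup>2) \<partial>lebesgue) = (\<integral>\<^sup>+s\<in>S. ennreal ((f s)\<^sup>2) \<partial>lebesgue)"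
      if "S \<subseteq> {0..}" for S
      using that by (intro nn_integral_cong) (auto simp: indicator_def g_def)
    have g_fin: "(\<integral>\<^sup>+s\<in>{0..K}. ennreal ((g s)\<^sup>2) \<partial>lebesgue) < \<infinity>" if "K > 0" for K
    proof -
      have "integrable lebesgue (\<lambda>s. indicator {0..K} s *\<^sub>R (f s)\<^sup>2)"
        using assms(14)[OF that] by (simp add: set_integrable_def)
      then have "(\<integral>\<^sup>+s. ennreal (indicator {0..K} s *\<^sub>R (f s)\<^sup>2) \<partial>lebesgue) < \<infinity>"
        by (subst nn_integral_eq_integral) auto
      also have "(\<integral>\<^sup>+s. ennreal (indicator {0..K} s *\<^sub>R (f s)\<^sup>2) \<partial>lebesgue) =
          (\<integral>\<^sup>+s\<in>{0..K}. ennreal ((f s)\<^sup>2) \<partial>lebesgue)"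
        by (intro nn_integral_cong) (auto simp: indicator_def)
      finally show ?thesis by (simp add: g_square)
    qed
    have g_inf: "(\<integral>\<^sup>+s\<in>{0..}. ennreal ((g s)\<^sup>2) \<partial>lebesgue) = \<infinity>"
      using assms(15) by (simp add: g_square)
    interpret wiener_clock P W g A I
    proof
      show "wiener_integral P W g t (I t)" if "0 \<le> t" for t
        using assms(17) that
        by (intro wiener_integral_cong[OF g[symmetric]]) (simp_all add: continuous_wiener_process_def)
      show "\<exists>u>t. ennreal B \<le> (\<integral>\<^sup>+s\<in>{t<..u}. ennreal ((g s)\<^sup>2) \<partial>lebesgue)" if "0 \<le> t" for t B
        by (rule square_integral_tail_unbounded[OF g_measurable g_fin g_inf that])
    qed (use g_measurable I_cont antiderivative_unbounded[OF a A \<eta>L] in auto)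
    have "AE \<omega> in P. explosion_time X \<omega> < \<infinity>"
      using sol clock_unbounded[of "r - \<xi>"]
    proof eventually_elim
      case (elim \<omega>)
      show ?case
      proof (rule ccontr)
        assume "\<not> explosion_time X \<omega> < \<infinity>"
        then have "solution_path a b \<xi> (\<lambda>t. I t \<omega>) \<infinity> (\<lambda>t. X t \<omega>)" using elim(1) by simp
        from global_solution_path_clock[OF this a A b G B] elim(2) show False by blast
      qed
    qed
    moreover have "{\<omega> \<in> space P. explosion_time X \<omega> < \<infinity>} \<in> events"
      by (rule P.in_sets_AE[of "space P"]) (use calculation in auto)
    ultimately show "blows_up_almost_surely P X"
      unfolding blows_up_almost_surely_def by (simp only: prob_Collect_eq_1)
  qed
  also have "\<dots> \<longleftrightarrow> (\<integral>\<^sup>+x\<in>{r..}. ennreal (1 / b x) \<partial>lebesgue) < \<infinity>"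
    by (rule osgood_integral_finite_iff[OF b(1,3) G, symmetric])
  finally show ?thesis .
qed

end
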